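(* Let $E$ be a finite directed graph with $E^1\ne\varnothing$ such that for all $v,w\in E^0$ there is a path $\mu\in E^*$ with $r(\mu)=v$, $s(\mu)=w$. Let $p\colon E^1\to\mathbb N\setminus\{0\}$ be a function, let $(\mathcal G,F^* )$ be the associated matched pair (graph of odometers) described in the context, let $M\colon\mathbb ZE^1\to\mathbb ZE^0$ be the homomorphism $M(e)=p(e)r(e)-s(e)$, and let $\chi(E)=|E^0|-|E^1|$. (i) If $p(e)=1$ for all $e\in E^1$, then $H_0^{\bowtie}(\mathcal G,F^* )\cong\mathbb Z$, $H_1^{\bowtie}(\mathcal G,F^* )\cong\mathbb Z^{2-\chi(E)}$, and $H_2^{\bowtie}(\mathcal G,F^* )\cong\mathbb Z^{1-\chi(E)}$. (ii) If $p(e)>1$ for some $e\in E^1$, then $\operatorname{coker}(M)$ is a finite cyclic group, $H_0^{\bowtie}(\mathcal G,F^* )\cong\mathbb Z$, $H_2^{\bowtie}(\mathcal G,F^* )\cong\mathbb Z^{-\chi(E)}$, and there is a short exact sequence $$0\to\mathbb Z^{1-\chi(E)}\to H_1^{\bowtie}(\mathcal G,F^* )\to\operatorname{coker}(M)\to0.$$ If moreover $\gcd\{p(\mu)-p(\nu):\mu,\nu\in E^*,\ s(\mu)=s(\nu),\ r(\mu)=r(\nu)\}=1$, then $\operatorname{coker}(M)=0$ and $H_1^{\bowtie}(\mathcal G,F^* )\cong\mathbb Z^{1-\chi(E)}$.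
   Context: Directed graphs and path categories. A directed graph $E=(E^0,E^1,r,s)$ has vertices $E^0$, edges $E^1$, range and source maps $r,s\colon E^1\to E^0$. Paths are $\mu=\mu_1\cdots\mu_n$ with $s(\mu_i)=r(\mu_{i+1})$, $r(\mu)=r(\mu_1)$, $s(\mu)=s(\mu_n)$; vertices are paths of length $0$. $E^*$ is the path category: morphisms are all finite paths, objects $E^0$, composition concatenation. The function $p$ is extended multiplicatively to $E^*$: $p(\mu_1\cdots\mu_n)=\prod_ip(\mu_i)$, $p(v)=1$ for vertices. Categorical homology. A small category $\mathcal E$ is identified with its set of morphisms, $\mathcal E^0$ its objects (identities), $r,s$ codomain and domain, $\mathcal E^k$ the composable $k$-tuples. $C_k(\mathcal E)=\mathbb Z\mathcal E^k$, with $d_k\colon C_{k+1}(\mathcal E)\to C_k(\mathcal E)$, $d_k[e_0,\dots,e_k]=[e_1,\dots,e_k]+\sum_{i=1}^k(-1)^i[e_0,\dots,e_{i-1}e_i,\dots,e_k]+(-1)^{k+1}[e_0,\dots,e_{k-1}]$ for $k\ge1$ and $d_0[e]=[s(e)]-[r(e)]$; $H_\bullet(\mathcal E)$ is the homology. Matched pairs and Zappa–Szép products. A matched pair $(\mathcal C,\mathcal D)$ consists of small categories with $\mathcal C^0=\mathcal D^0$, a left action $\triangleright$ of $\mathcal C$ on $\mathcal D$ and a right action $\triangleleft$ of $\mathcal D$ on $\mathcal C$ (both defined on pairs $(c,d)$ with $s(c)=r(d)$) with $s(c\triangleright d)=r(c\triangleleft d)$, $c\triangleright(d_1d_2)=(c\triangleright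 d_1)((c\triangleleft d_1)\triangleright d_2)$, $(c_1c_2)\triangleleft d=(c_1\triangleleft(c_2\triangleright d))(c_2\triangleleft d)$. $\mathcal C\bowtie\mathcal D$ is the category with morphisms $dc:=(d,c)$, $s(d)=r(c)$, $r(dc)=r(d)$, $s(dc)=s(c)$, composition $(d_1c_1)(d_2c_2)=(d_1(c_1\triangleright d_2))((c_1\triangleleft d_2)c_2)$. $H^{\bowtie}_\bullet(\mathcal C,\mathcal D):=H_\bullet(\mathcal C\bowtie\mathcal D)$. The graph of odometers. Given $E$ and $p$, let $F^0=E^0$, $F^1=\{(e,i): e\in E^1,\ i\in\mathbb Z/p(e)\mathbb Z\}$, $r(e,i)=r(e)$, $s(e,i)=s(e)$. Let $\mathcal G=E^0\times\mathbb Z$, the groupoid that is a bundle of copies of $\mathbb Z$ over $E^0$. The matched pair structure on $(\mathcal G,F^* )$ is the unique extension, preserving path length, of $(r(e),1)\triangleright(e,i)=(e,i+1 \bmod p(e))$ and $(r(e),1)\triangleleft(e,i)=(s(e),1)$ if $i=p(e)-1$, $=(s(e),0)$ otherwise. Explicitly, representing $i$ by an element of $\{0,\dots,p(e)-1\}$, $(r(e),a)\triangleright(e,i)=(e,a+i\bmod p(e))$, $(r(e),a)\triangleleft(e,i)=(s(e),\lfloor(a+i)/p(e)\rfloor)$ for $a\in\mathbb Z$, extended to paths by $g\triangleright(f\xi)=(g\triangleright f)((g\triangleleft f)\triangleright\xi)$ and $g\triangleleft(f\xi)=(g\triangleleft f)\triangleleft\xi$. *)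

theory Defs
  imports
    "HOL-Algebra.Free_Abelian_Groups"
    "Graph_Theory.Digraph"
begin

section \<open>Small categories and their homology\<close>

record ('o, 'm) category =
  cat_obj :: "'o set"
  cat_mor :: "'m set"
  cat_cod :: "'m \<Rightarrow> 'o"
  cat_dom :: "'m \<Rightarrow> 'o"
  cat_id :: "'o \<Rightarrow> 'm"
  cat_comp :: "'m \<Rightarrow> 'm \<Rightarrow> 'm"

text \<open>Composites are written as in \<open>c\<^sub>1 c\<^sub>2\<close> with \<open>s(c\<^sub>1) = r(c\<^sub>2)\<close>, where \<open>r\<close> is the
  codomain and \<open>s\<close> the domain.\<close>

locale small_category =
  fixes C :: "('o, 'm) category"
  assumes cod_obj: "c \<in> cat_mor C \<Longrightarrow> cat_cod C c \<in> cat_obj C"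
    and dom_obj: "c \<in> cat_mor C \<Longrightarrow> cat_dom C c \<in> cat_obj C"
    and id_mor: "v \<in> cat_obj C \<Longrightarrow> cat_id C v \<in> cat_mor C"
    and cod_id: "v \<in> cat_obj C \<Longrightarrow> cat_cod C (cat_id C v) = v"
    and dom_id: "v \<in> cat_obj C \<Longrightarrow> cat_dom C (cat_id C v) = v"
    and comp_mor: "\<lbrakk>c \<in> cat_mor C; d \<in> cat_mor C; cat_dom C c = cat_cod C d\<rbrakk>
          \<Longrightarrow> cat_comp C c d \<in> cat_mor C"
    and cod_comp: "\<lbrakk>c \<in> cat_mor C; d \<in> cat_mor C; cat_dom C c = cat_cod C d\<rbrakk>
          \<Longrightarrow> cat_cod C (cat_comp C c d) = cat_cod C c"
    and dom_comp: "\<lbrakk>c \<in> cat_mor C; d \<in> cat_mor C; cat_dom C c = cat_cod C d\<rbrakk>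
          \<Longrightarrow> cat_dom C (cat_comp C c d) = cat_dom C d"
    and id_comp: "c \<in> cat_mor C \<Longrightarrow> cat_comp C (cat_id C (cat_cod C c)) c = c"
    and comp_id: "c \<in> cat_mor C \<Longrightarrow> cat_comp C c (cat_id C (cat_dom C c)) = c"
    and comp_assoc: "\<lbrakk>c \<in> cat_mor C; d \<in> cat_mor C; e \<in> cat_mor C;
            cat_dom C c = cat_cod C d; cat_dom C d = cat_cod C e\<rbrakk>
          \<Longrightarrow> cat_comp C (cat_comp C c d) e = cat_comp C c (cat_comp C d e)"

text \<open>A \<open>0\<close>-simplex is an object, a \<open>k\<close>-simplex for \<open>k \<ge> 1\<close> is a composable \<open>k\<close>-tuple of
  morphisms (identities are allowed: the complex is not normalised).\<close>

datatype ('o, 'm) simplex = Vertex 'o | Tuple "'m list"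

definition composable :: "('o, 'm) category \<Rightarrow> 'm list \<Rightarrow> bool" where
  "composable C es \<longleftrightarrow> set es \<subseteq> cat_mor C \<and>
     (\<forall>i. Suc i < length es \<longrightarrow> cat_dom C (es ! i) = cat_cod C (es ! Suc i))"

definition simplices :: "('o, 'm) category \<Rightarrow> nat \<Rightarrow> ('o, 'm) simplex set" where
  "simplices C k =
     (if k = 0 then Vertex ` cat_obj C else Tuple ` {es. length es = k \<and> composable C es})"

definition cat_chains :: "('o, 'm) category \<Rightarrow> nat \<Rightarrow> (('o, 'm) simplex \<Rightarrow>\<^sub>0 int) monoid" where
  "cat_chains C k = free_Abelian_group (simplices C k)"

definition merge_at :: "('o, 'm) category \<Rightarrow> nat \<Rightarrow> 'm list \<Rightarrow> 'm list" where
  "merge_at C i es = take (i - 1) es @ [cat_comp C (es ! (i - 1)) (es ! i)] @ drop (Suc i) es"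

text \<open>The map \<open>d\<^sub>k : C\<^sub>k\<^sub>+\<^sub>1 \<rightarrow> C\<^sub>k\<close> on basis elements; only \<open>Tuple\<close>s occur in degree \<open>k + 1\<close>.\<close>

fun simplex_boundary ::
    "('o, 'm) category \<Rightarrow> nat \<Rightarrow> ('o, 'm) simplex \<Rightarrow> (('o, 'm) simplex \<Rightarrow>\<^sub>0 int)" where
  "simplex_boundary C k (Vertex v) = 0"
| "simplex_boundary C k (Tuple es) =
     (if k = 0
      then frag_of (Vertex (cat_dom C (es ! 0))) - frag_of (Vertex (cat_cod C (es ! 0)))
      else frag_of (Tuple (drop 1 es))
         + (\<Sum>i = 1..k. frag_cmul ((-1) ^ i) (frag_of (Tuple (merge_at C i es))))
         + frag_cmul ((-1) ^ (k + 1)) (frag_of (Tuple (take k es))))"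

definition cat_boundary ::
    "('o, 'm) category \<Rightarrow> nat \<Rightarrow> (('o, 'm) simplex \<Rightarrow>\<^sub>0 int) \<Rightarrow> (('o, 'm) simplex \<Rightarrow>\<^sub>0 int)" where
  "cat_boundary C k = frag_extend (simplex_boundary C k)"

definition cat_cycles :: "('o, 'm) category \<Rightarrow> nat \<Rightarrow> (('o, 'm) simplex \<Rightarrow>\<^sub>0 int) set" where
  "cat_cycles C k =
     (case k of 0 \<Rightarrow> carrier (cat_chains C 0)
      | Suc j \<Rightarrow> kernel (cat_chains C (Suc j)) (cat_chains C j) (cat_boundary C j))"

definition cat_homology ::
    "nat \<Rightarrow> ('o, 'm) category \<Rightarrow> (('o, 'm) simplex \<Rightarrow>\<^sub>0 int) set monoid" where
  "cat_homology k C = subgroup_generated (cat_chains C k) (cat_cycles C k)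
                        Mod (cat_boundary C k ` carrier (cat_chains C (Suc k)))"

section \<open>Matched pairs and Zappa-Szep products\<close>

text \<open>\<open>lact c d\<close> is \<open>c \<triangleright> d\<close> and \<open>ract c d\<close> is \<open>c \<triangleleft> d\<close>; both are meaningful only when
  \<open>s(c) = r(d)\<close>. The axioms \<open>lact_id\<close> and \<open>ract_id\<close> are needed for the identities of \<open>C\<close> and \<open>D\<close>
  to be identities in the product category.\<close>

locale matched_pair = C: small_category C + D: small_category D
  for C :: "('o, 'c) category" and D :: "('o, 'd) category" +
  fixes lact :: "'c \<Rightarrow> 'd \<Rightarrow> 'd" and ract :: "'c \<Rightarrow> 'd \<Rightarrow> 'c"
  assumes same_obj: "cat_obj C = cat_obj D"
    and lact_mor: "\<lbrakk>c \<in> cat_mor C; d \<in> cat_mor D; cat_dom C c = cat_cod D d\<rbrakk>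
          \<Longrightarrow> lact c d \<in> cat_mor D"
    and ract_mor: "\<lbrakk>c \<in> cat_mor C; d \<in> cat_mor D; cat_dom C c = cat_cod D d\<rbrakk>
          \<Longrightarrow> ract c d \<in> cat_mor C"
    and cod_lact: "\<lbrakk>c \<in> cat_mor C; d \<in> cat_mor D; cat_dom C c = cat_cod D d\<rbrakk>
          \<Longrightarrow> cat_cod D (lact c d) = cat_cod C c"
    and dom_ract: "\<lbrakk>c \<in> cat_mor C; d \<in> cat_mor D; cat_dom C c = cat_cod D d\<rbrakk>
          \<Longrightarrow> cat_dom C (ract c d) = cat_dom D d"
    and id_lact: "d \<in> cat_mor D \<Longrightarrow> lact (cat_id C (cat_cod D d)) d = d"
    and ract_of_id: "c \<in> cat_mor C \<Longrightarrow> ract c (cat_id D (cat_dom C c)) = c"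
    and comp_lact: "\<lbrakk>c1 \<in> cat_mor C; c2 \<in> cat_mor C; d \<in> cat_mor D;
            cat_dom C c1 = cat_cod C c2; cat_dom C c2 = cat_cod D d\<rbrakk>
          \<Longrightarrow> lact (cat_comp C c1 c2) d = lact c1 (lact c2 d)"
    and ract_comp: "\<lbrakk>c \<in> cat_mor C; d1 \<in> cat_mor D; d2 \<in> cat_mor D;
            cat_dom C c = cat_cod D d1; cat_dom D d1 = cat_cod D d2\<rbrakk>
          \<Longrightarrow> ract c (cat_comp D d1 d2) = ract (ract c d1) d2"
    and lact_id: "c \<in> cat_mor C \<Longrightarrow> lact c (cat_id D (cat_dom C c)) = cat_id D (cat_cod C c)"
    and ract_id: "d \<in> cat_mor D \<Longrightarrow> ract (cat_id C (cat_cod D d)) d = cat_id C (cat_dom D d)"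
    and dom_lact: "\<lbrakk>c \<in> cat_mor C; d \<in> cat_mor D; cat_dom C c = cat_cod D d\<rbrakk>
          \<Longrightarrow> cat_dom D (lact c d) = cat_cod C (ract c d)"
    and lact_comp: "\<lbrakk>c \<in> cat_mor C; d1 \<in> cat_mor D; d2 \<in> cat_mor D;
            cat_dom C c = cat_cod D d1; cat_dom D d1 = cat_cod D d2\<rbrakk>
          \<Longrightarrow> lact c (cat_comp D d1 d2) = cat_comp D (lact c d1) (lact (ract c d1) d2)"
    and comp_ract: "\<lbrakk>c1 \<in> cat_mor C; c2 \<in> cat_mor C; d \<in> cat_mor D;
            cat_dom C c1 = cat_cod C c2; cat_dom C c2 = cat_cod D d\<rbrakk>
          \<Longrightarrow> ract (cat_comp C c1 c2) d = cat_comp C (ract c1 (lact c2 d)) (ract c2 d)"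

definition zappa_szep ::
    "('o, 'c) category \<Rightarrow> ('o, 'd) category \<Rightarrow> ('c \<Rightarrow> 'd \<Rightarrow> 'd) \<Rightarrow> ('c \<Rightarrow> 'd \<Rightarrow> 'c)
      \<Rightarrow> ('o, 'd \<times> 'c) category" where
  "zappa_szep C D lact ract =
     \<lparr>cat_obj = cat_obj C,
      cat_mor = {(d, c). d \<in> cat_mor D \<and> c \<in> cat_mor C \<and> cat_dom D d = cat_cod C c},
      cat_cod = (\<lambda>(d, c). cat_cod D d),
      cat_dom = (\<lambda>(d, c). cat_dom C c),
      cat_id = (\<lambda>v. (cat_id D v, cat_id C v)),
      cat_comp = (\<lambda>(d1, c1) (d2, c2).
         (cat_comp D d1 (lact c1 d2), cat_comp C (ract c1 d2) c2))\<rparr>"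

lemma (in matched_pair) small_category_zappa_szep:
  "small_category (zappa_szep C D lact ract)"
proof unfold_locales
  fix x y z
  assume "x \<in> cat_mor (zappa_szep C D lact ract)" "y \<in> cat_mor (zappa_szep C D lact ract)"
    "z \<in> cat_mor (zappa_szep C D lact ract)"
    "cat_dom (zappa_szep C D lact ract) x = cat_cod (zappa_szep C D lact ract) y"
    "cat_dom (zappa_szep C D lact ract) y = cat_cod (zappa_szep C D lact ract) z"
  then obtain d1 c1 d2 c2 d3 c3 where xyz: "x = (d1, c1)" "y = (d2, c2)" "z = (d3, c3)"
    and mor: "d1 \<in> cat_mor D" "d2 \<in> cat_mor D" "d3 \<in> cat_mor D"
      "c1 \<in> cat_mor C" "c2 \<in> cat_mor C" "c3 \<in> cat_mor C"
    and eqs: "cat_dom D d1 = cat_cod C c1" "cat_dom D d2 = cat_cod C c2"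
      "cat_dom D d3 = cat_cod C c3" "cat_dom C c1 = cat_cod D d2" "cat_dom C c2 = cat_cod D d3"
    by (auto simp: zappa_szep_def)
  have "lact (cat_comp C (ract c1 d2) c2) d3 = lact (ract c1 d2) (lact c2 d3)"
    using mor eqs by (simp add: comp_lact ract_mor dom_ract)
  moreover have "lact c1 (cat_comp D d2 (lact c2 d3))
      = cat_comp D (lact c1 d2) (lact (ract c1 d2) (lact c2 d3))"
    using mor eqs by (simp add: lact_comp lact_mor cod_lact)
  moreover have "ract (cat_comp C (ract c1 d2) c2) d3
      = cat_comp C (ract (ract c1 d2) (lact c2 d3)) (ract c2 d3)"
    using mor eqs by (simp add: comp_ract ract_mor dom_ract)
  moreover have "ract c1 (cat_comp D d2 (lact c2 d3)) = ract (ract c1 d2) (lact c2 d3)"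
    using mor eqs by (simp add: ract_comp lact_mor cod_lact)
  ultimately show "cat_comp (zappa_szep C D lact ract) (cat_comp (zappa_szep C D lact ract) x y) z
      = cat_comp (zappa_szep C D lact ract) x (cat_comp (zappa_szep C D lact ract) y z)"
    using mor eqs
    by (simp add: xyz zappa_szep_def D.comp_assoc C.comp_assoc lact_mor ract_mor cod_lact dom_lact
        dom_ract)
qed (auto simp: zappa_szep_def same_obj C.dom_obj[unfolded same_obj] D.cod_obj
      C.id_mor[unfolded same_obj] D.id_mor C.cod_id[unfolded same_obj] D.cod_id
      C.dom_id[unfolded same_obj] D.dom_id
      C.comp_mor D.comp_mor C.cod_comp D.cod_comp C.dom_comp D.dom_comp
      lact_mor ract_mor cod_lact dom_ract dom_lact
      C.id_comp C.comp_id D.id_comp D.comp_id id_lact ract_of_id lact_id ract_id,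
    metis D.comp_id)

definition zs_homology ::
    "nat \<Rightarrow> ('o, 'c) category \<Rightarrow> ('o, 'd) category \<Rightarrow> ('c \<Rightarrow> 'd \<Rightarrow> 'd) \<Rightarrow> ('c \<Rightarrow> 'd \<Rightarrow> 'c)
      \<Rightarrow> (('o, 'd \<times> 'c) simplex \<Rightarrow>\<^sub>0 int) set monoid" where
  "zs_homology k C D lact ract = cat_homology k (zappa_szep C D lact ract)"

section \<open>Path categories\<close>

text \<open>In a digraph \<open>E\<close>, \<open>head E\<close> is the range map and \<open>tail E\<close> the source map. A path is encoded
  by its range together with its list of edges \<open>\<mu>\<^sub>1 \<cdots> \<mu>\<^sub>n\<close>, where \<open>s(\<mu>\<^sub>i) = r(\<mu>\<^sub>i\<^sub>+\<^sub>1)\<close>; the vertex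
  \<open>v\<close> is the path \<open>(v, [])\<close>.\<close>

fun is_path :: "('v, 'e) pre_digraph \<Rightarrow> 'v \<Rightarrow> 'e list \<Rightarrow> bool" where
  "is_path E v [] \<longleftrightarrow> v \<in> verts E"
| "is_path E v (e # es) \<longleftrightarrow> e \<in> arcs E \<and> head E e = v \<and> is_path E (tail E e) es"

definition paths :: "('v, 'e) pre_digraph \<Rightarrow> ('v \<times> 'e list) set" where
  "paths E = {(v, es). is_path E v es}"

definition path_range :: "('v \<times> 'e list) \<Rightarrow> 'v" where
  "path_range \<mu> = fst \<mu>"

definition path_source :: "('v, 'e) pre_digraph \<Rightarrow> ('v \<times> 'e list) \<Rightarrow> 'v" where
  "path_source E \<mu> = (if snd \<mu> = [] then fst \<mu> else tail E (last (snd \<mu>)))"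

definition path_category :: "('v, 'e) pre_digraph \<Rightarrow> ('v, 'v \<times> 'e list) category" where
  "path_category E =
     \<lparr>cat_obj = verts E, cat_mor = paths E, cat_cod = path_range, cat_dom = path_source E,
      cat_id = (\<lambda>v. (v, [])), cat_comp = (\<lambda>\<mu> \<nu>. (fst \<mu>, snd \<mu> @ snd \<nu>))\<rparr>"

definition path_weight :: "('e \<Rightarrow> nat) \<Rightarrow> ('v \<times> 'e list) \<Rightarrow> nat" where
  "path_weight p \<mu> = prod_list (map p (snd \<mu>))"

section \<open>The graph of odometers\<close>

text \<open>\<open>\<int>/p(e)\<int>\<close> is represented by \<open>{0..<p(e)}\<close>.\<close>

definition odometer_graph ::
    "('v, 'e) pre_digraph \<Rightarrow> ('e \<Rightarrow> nat) \<Rightarrow> ('v, 'e \<times> int) pre_digraph" where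
  "odometer_graph E p =
     \<lparr>verts = verts E, arcs = {(e, i). e \<in> arcs E \<and> 0 \<le> i \<and> i < int (p e)},
      tail = (\<lambda>(e, i). tail E e), head = (\<lambda>(e, i). head E e)\<rparr>"

definition integer_bundle :: "'v set \<Rightarrow> ('v, 'v \<times> int) category" where
  "integer_bundle V =
     \<lparr>cat_obj = V, cat_mor = V \<times> UNIV, cat_cod = fst, cat_dom = fst,
      cat_id = (\<lambda>v. (v, 0)), cat_comp = (\<lambda>(v, a) (w, b). (v, a + b))\<rparr>"

text \<open>The action of \<open>a \<in> \<int>\<close> on edge lists of the odometer graph, and the integer carried past
  the end of the list; \<open>div\<close> and \<open>mod\<close> on integers are floor division and its remainder.\<close>

fun odometer_move :: "('e \<Rightarrow> nat) \<Rightarrow> int \<Rightarrow> ('e \<times> int) list \<Rightarrow> ('e \<times> int) list" where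
  "odometer_move p a [] = []"
| "odometer_move p a ((e, i) # \<xi>) =
     (e, (a + i) mod int (p e)) # odometer_move p ((a + i) div int (p e)) \<xi>"

fun odometer_carry :: "('e \<Rightarrow> nat) \<Rightarrow> int \<Rightarrow> ('e \<times> int) list \<Rightarrow> int" where
  "odometer_carry p a [] = a"
| "odometer_carry p a ((e, i) # \<xi>) = odometer_carry p ((a + i) div int (p e)) \<xi>"

definition odometer_lact ::
    "('e \<Rightarrow> nat) \<Rightarrow> 'v \<times> int \<Rightarrow> 'v \<times> ('e \<times> int) list \<Rightarrow> 'v \<times> ('e \<times> int) list" where
  "odometer_lact p g \<xi> = (fst g, odometer_move p (snd g) (snd \<xi>))"

definition odometer_ract ::
    "('v, 'e) pre_digraph \<Rightarrow> ('e \<Rightarrow> nat) \<Rightarrow> 'v \<times> int \<Rightarrow> 'v \<times> ('e \<times> int) list \<Rightarrow> 'v \<times> int" where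
  "odometer_ract E p g \<xi> =
     (path_source (odometer_graph E p) \<xi>, odometer_carry p (snd g) (snd \<xi>))"

definition odometer_homology ::
    "nat \<Rightarrow> ('v, 'e) pre_digraph \<Rightarrow> ('e \<Rightarrow> nat)
      \<Rightarrow> (('v, ('v \<times> ('e \<times> int) list) \<times> ('v \<times> int)) simplex \<Rightarrow>\<^sub>0 int) set monoid" where
  "odometer_homology k E p =
     zs_homology k (integer_bundle (verts E)) (path_category (odometer_graph E p))
       (odometer_lact p) (odometer_ract E p)"

lemma wf_odometer_graph: "wf_digraph E \<Longrightarrow> wf_digraph (odometer_graph E p)"
  by (auto simp: wf_digraph_def odometer_graph_def)

lemma small_category_integer_bundle: "small_category (integer_bundle V)"
  by unfold_locales (auto simp: integer_bundle_def)

lemma path_source_Nil [simp]: "path_source E (v, []) = v"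
  by (simp add: path_source_def)

lemma path_source_Cons: "path_source E (v, e # es) = path_source E (tail E e, es)"
  by (auto simp: path_source_def)

lemma is_path_range: "wf_digraph E \<Longrightarrow> is_path E v es \<Longrightarrow> v \<in> verts E"
  by (cases es) (auto simp: wf_digraph_def)

lemma is_path_source: "wf_digraph E \<Longrightarrow> is_path E v es \<Longrightarrow> path_source E (v, es) \<in> verts E"
  by (induction E v es rule: is_path.induct) (auto simp: path_source_Cons wf_digraph_def)

lemma is_path_append:
  "wf_digraph E \<Longrightarrow> is_path E v (es @ fs) \<longleftrightarrow> is_path E v es \<and> is_path E (path_source E (v, es)) fs"
  by (induction E v es rule: is_path.induct)
    (auto simp: path_source_Cons is_path_range)

lemma path_source_append:
  "path_source E (v, es @ fs) = path_source E (path_source E (v, es), fs)"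
  by (auto simp: path_source_def)

lemma small_category_path_category:
  assumes "wf_digraph E"
  shows "small_category (path_category E)"
  using assms
  by unfold_locales
    (auto simp: path_category_def paths_def path_range_def is_path_range is_path_source
      is_path_append path_source_append)

lemma odometer_div_mod:
  fixes a b i n :: int
  shows "(a + b + i) mod n = (a + (b + i) mod n) mod n"
    and "(a + b + i) div n = (a + (b + i) mod n) div n + (b + i) div n"
proof -
  have eq: "a + b + i = (a + (b + i) mod n) + ((b + i) div n) * n"
    using div_mult_mod_eq[of "b + i" n] by linarith
  show "(a + b + i) mod n = (a + (b + i) mod n) mod n"
    by (metis add.assoc mod_add_right_eq)
  show "(a + b + i) div n = (a + (b + i) mod n) div n + (b + i) div n"
  proof (cases "n = 0")
    case False
    then show ?thesis
      using div_mult_self1[of n "a + (b + i) mod n" "(b + i) div n"] eq by (simp add: ac_simps)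
  qed simp
qed

lemma odometer_move_add:
  "odometer_move p (a + b) \<xi> = odometer_move p a (odometer_move p b \<xi>)"
  by (induction p b \<xi> arbitrary: a rule: odometer_move.induct)
    (simp_all add: odometer_div_mod)

lemma odometer_carry_add:
  "odometer_carry p (a + b) \<xi> = odometer_carry p a (odometer_move p b \<xi>) + odometer_carry p b \<xi>"
  by (induction p b \<xi> arbitrary: a rule: odometer_move.induct)
    (simp_all add: odometer_div_mod)

lemma odometer_move_append:
  "odometer_move p a (\<xi> @ \<eta>) = odometer_move p a \<xi> @ odometer_move p (odometer_carry p a \<xi>) \<eta>"
  by (induction p a \<xi> rule: odometer_move.induct) simp_all

lemma odometer_carry_append:
  "odometer_carry p a (\<xi> @ \<eta>) = odometer_carry p (odometer_carry p a \<xi>) \<eta>"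
  by (induction p a \<xi> rule: odometer_move.induct) simp_all

lemma odometer_zero:
  assumes "is_path (odometer_graph E p) v \<xi>"
  shows "odometer_move p 0 \<xi> = \<xi>" and "odometer_carry p 0 \<xi> = 0"
  using assms
  by (induction "odometer_graph E p" v \<xi> rule: is_path.induct)
    (auto simp: odometer_graph_def)

lemma is_path_odometer_move:
  assumes "is_path (odometer_graph E p) v \<xi>" and "\<And>e. e \<in> arcs E \<Longrightarrow> 0 < p e"
  shows "is_path (odometer_graph E p) v (odometer_move p a \<xi>)"
  using assms
  by (induction p a \<xi> arbitrary: v rule: odometer_move.induct) (auto simp: odometer_graph_def)

lemma path_source_odometer_move:
  "path_source (odometer_graph E p) (v, odometer_move p a \<xi>) = path_source (odometer_graph E p) (v, \<xi>)"
proof (induction p a \<xi> arbitrary: v rule: odometer_move.induct)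
  case (2 p a e i \<xi>)
  then show ?case by (simp add: path_source_Cons) (simp add: odometer_graph_def)
qed simp

lemma odometer_matched_pair:
  fixes E :: "('v, 'e) pre_digraph"
  assumes "wf_digraph E" and p: "\<And>e. e \<in> arcs E \<Longrightarrow> 0 < p e"
  shows "matched_pair (integer_bundle (verts E)) (path_category (odometer_graph E p))
           (odometer_lact p) (odometer_ract E p)"
proof -
  have F: "wf_digraph (odometer_graph E p)"
    using assms(1) by (rule wf_odometer_graph)
  interpret C: small_category "integer_bundle (verts E)"
    by (rule small_category_integer_bundle)
  interpret D: small_category "path_category (odometer_graph E p)"
    using F by (rule small_category_path_category)
  have V: "verts (odometer_graph E p) = verts E"
    by (simp add: odometer_graph_def)
  note src = is_path_source[OF F, unfolded V]
  show ?thesis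
    by unfold_locales
      (auto simp: integer_bundle_def path_category_def paths_def path_range_def
        odometer_lact_def odometer_ract_def V src is_path_odometer_move p
        path_source_odometer_move path_source_append odometer_zero odometer_move_add
        odometer_carry_add odometer_move_append odometer_carry_append)
qed

section \<open>The cokernel and powers of the integers\<close>

definition odometer_M :: "('v, 'e) pre_digraph \<Rightarrow> ('e \<Rightarrow> nat) \<Rightarrow> ('e \<Rightarrow>\<^sub>0 int) \<Rightarrow> ('v \<Rightarrow>\<^sub>0 int)" where
  "odometer_M E p =
     frag_extend (\<lambda>e. frag_cmul (int (p e)) (frag_of (head E e)) - frag_of (tail E e))"

definition odometer_coker :: "('v, 'e) pre_digraph \<Rightarrow> ('e \<Rightarrow> nat) \<Rightarrow> ('v \<Rightarrow>\<^sub>0 int) set monoid" where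
  "odometer_coker E p =
     free_Abelian_group (verts E) Mod (odometer_M E p ` carrier (free_Abelian_group (arcs E)))"

definition euler_char :: "('v, 'e) pre_digraph \<Rightarrow> int" where
  "euler_char E = int (card (verts E)) - int (card (arcs E))"

definition int_power :: "nat \<Rightarrow> (nat \<Rightarrow> int) monoid" where
  "int_power n = product_group {..<n} (\<lambda>_. integer_group)"

end

theory Submission
  imports Defs
begin

text \<open>The product category is generated by the units \<open>g\<^sub>v = (v, 1)\<close> of the copies of \<open>\<int>\<close> and the edges
  \<open>e = (e, 0)\<close>, with relations \<open>g\<^sub>v\<^sup>p e = e g\<^sub>w\<close> for \<open>v = r(e)\<close>, \<open>w = s(e)\<close>, \<open>p = p(e)\<close>. Its homology is
  therefore that of a complex with a \<open>0\<close>-cell for each vertex, a \<open>1\<close>-cell for each vertex and each edge,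
  and a \<open>2\<close>-cell for each edge: \<open>H\<^sub>2 = ker M\<close> and \<open>H\<^sub>1 = coker M \<oplus> ker \<partial>\<close>, where \<open>\<partial>(e) = s(e) - r(e)\<close>.
  The comparison map counts, in degree \<open>2\<close>, the carries of the odometer. It is injective on homology by
  an extension argument: the universal \<open>2\<close>-cocycle, with values in the \<open>2\<close>-chains modulo boundaries,
  becomes a coboundary once the classes of the defining relations are divided out.\<close>

section \<open>Kernels of homomorphisms of free abelian groups\<close>

text \<open>Every morphism has a unique normal form \<open>g^i1 e1 g^i2 e2 ... g^a\<close>, because
  the edge (e, i) is \<open>g^i e\<close> for 0 \<le> i < p(e). This word dictates all chains: a
  2-chain joins a morphism to the sum of its letters, and relation chains repair the failure of
  normal forms to multiply. The resulting identity,
  \<open>z - homotopy (d 1 z) - squares (square_part z)\<close> lies in \<open>B 2\<close>, is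
  claimed only modulo boundaries. That is enough to make a 2-cycle with vanishing carry count a
  boundary, so neither a homotopy in degree 3 nor a resolution is constructed. The obstacle is that
  a carry may travel along a path of any length. The cocycle identity reduces the check to pairs of
  generators, and there to exponents 0 \<le> a < p(e), where no carry occurs, and a = p(e), where
  one does. The ranks come from the graph. For weight 1 the image of M is the kernel of the
  augmentation, of corank one. A closed path through an edge of weight > 1 makes coker M torsion, of
  corank zero. This accounts for the two ranks 1 - \<chi> and -\<chi>.\<close>

lemmas frag_extend_linear = frag_extend_add frag_extend_diff frag_extend_minus frag_extend_cmul

section \<open>Chains supported on a given set\<close>

definition frag_space :: "'a set \<Rightarrow> ('a \<Rightarrow>\<^sub>0 int) set" where
  "frag_space S = {c. Poly_Mapping.keys c \<subseteq> S}"

lemma carrier_free_Abelian_group: "carrier (free_Abelian_group S) = frag_space S"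
  by (auto simp: frag_space_def)

lemma frag_space_simps [simp]:
  "0 \<in> frag_space S" "frag_of a \<in> frag_space S \<longleftrightarrow> a \<in> S"
  by (auto simp: frag_space_def)

lemma frag_space_intros [intro]:
  "x \<in> frag_space S \<Longrightarrow> y \<in> frag_space S \<Longrightarrow> x + y \<in> frag_space S"
  "x \<in> frag_space S \<Longrightarrow> y \<in> frag_space S \<Longrightarrow> x - y \<in> frag_space S"
  "x \<in> frag_space S \<Longrightarrow> - x \<in> frag_space S"
  "x \<in> frag_space S \<Longrightarrow> frag_cmul k x \<in> frag_space S"
  using keys_add[of x y] keys_diff[of x y] keys_cmul[of k x] by (auto simp: frag_space_def)

lemma sum_in_frag_space: "(\<And>i. i \<in> I \<Longrightarrow> f i \<in> frag_space S) \<Longrightarrow> sum f I \<in> frag_space S"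
  by (induction I rule: infinite_finite_induct) (auto intro: frag_space_intros)

lemma frag_extend_in_frag_space:
  "c \<in> frag_space S \<Longrightarrow> (\<And>x. x \<in> S \<Longrightarrow> f x \<in> frag_space T) \<Longrightarrow> frag_extend f c \<in> frag_space T"
  using keys_frag_extend[of f c] unfolding frag_space_def by blast

lemma frag_space_induct [consumes 1, case_names zero one diff]:
  assumes "c \<in> frag_space S" "P 0" "\<And>x. x \<in> S \<Longrightarrow> P (frag_of x)"
    and "\<And>a b. a \<in> frag_space S \<Longrightarrow> b \<in> frag_space S \<Longrightarrow> P a \<Longrightarrow> P b \<Longrightarrow> P (a - b)"
  shows "P c"
proof -
  have "c \<in> frag_space S \<and> P c"
    using assms(1)[unfolded frag_space_def, simplified]
    by (induction c rule: frag_induction) (use assms in \<open>auto\<close>)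
  then show ?thesis ..
qed

lemma frag_extend_eqI:
  assumes "c \<in> frag_space S" "\<And>x. x \<in> S \<Longrightarrow> f x = g x"
  shows "frag_extend f c = frag_extend g c"
  using assms by (intro frag_extend_eq) (auto simp: frag_space_def)

lemma frag_extend_frag_extend:
  "frag_extend f (frag_extend g c) = frag_extend (frag_extend f \<circ> g) c"
  by (rule frag_induction[of c UNIV]) (simp_all add: frag_extend_diff)

text \<open>A basis given as a linear bijection. Stating it on bare sets lets bases be composed and
  cut down without forming subgroups; \<open>free_of_rank_iso_int_power\<close> makes the passage to
  groups once.\<close>

definition free_of_rank :: "('a \<Rightarrow>\<^sub>0 int) set \<Rightarrow> nat \<Rightarrow> bool" where
  "free_of_rank A n \<longleftrightarrow> (\<exists>b :: nat \<Rightarrow> 'a \<Rightarrow>\<^sub>0 int. bij_betw (frag_extend b) (frag_space {..<n}) A)"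

lemma bij_betw_frag_extend_comp:
  assumes "bij_betw (frag_extend b) (frag_space I) A"
    and "bij_betw (frag_extend b') (frag_space J) B" and "B \<subseteq> frag_space I"
  shows "bij_betw (frag_extend (frag_extend b \<circ> b')) (frag_space J) (frag_extend b ` B)"
proof -
  have "bij_betw (frag_extend b) B (frag_extend b ` B)"
    using assms(1,3) by (auto simp: bij_betw_def intro: inj_on_subset)
  then have "bij_betw (frag_extend b \<circ> frag_extend b') (frag_space J) (frag_extend b ` B)"
    using assms(2) by (rule bij_betw_trans[rotated])
  moreover have "frag_extend b \<circ> frag_extend b' = frag_extend (frag_extend b \<circ> b')"
    by (auto simp: frag_extend_frag_extend)
  ultimately show ?thesis by simp
qed

lemma free_of_rank_frag_space:
  assumes "finite S"
  shows "free_of_rank (frag_space S) (card S)"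
proof -
  obtain f where f: "bij_betw f {..<card S} S"
    using ex_bij_betw_nat_finite[OF assms] by (auto simp: lessThan_atLeast0)
  define g where "g = inv_into {..<card S} f"
  have g: "\<And>x. x \<in> S \<Longrightarrow> f (g x) = x" "\<And>i. i < card S \<Longrightarrow> g (f i) = i"
    "\<And>x. x \<in> S \<Longrightarrow> g x < card S" "\<And>i. i < card S \<Longrightarrow> f i \<in> S"
    using f bij_betw_inv_into_right[OF f] bij_betw_inv_into_left[OF f] bij_betw_inv_into[OF f]
    by (auto simp: g_def bij_betw_def)
  have "bij_betw (frag_extend (frag_of \<circ> f)) (frag_space {..<card S}) (frag_space S)"
  proof (rule bij_betw_byWitness[where f' = "frag_extend (frag_of \<circ> g)"])
    show "\<forall>a\<in>frag_space {..<card S}.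
        frag_extend (frag_of \<circ> g) (frag_extend (frag_of \<circ> f) a) = a"
    proof
      fix a :: "nat \<Rightarrow>\<^sub>0 int" assume a: "a \<in> frag_space {..<card S}"
      show "frag_extend (frag_of \<circ> g) (frag_extend (frag_of \<circ> f) a) = a"
        unfolding frag_extend_frag_extend
        by (subst (2) frag_expansion, rule frag_extend_eqI[OF a]) (simp add: g)
    qed
    show "\<forall>a\<in>frag_space S. frag_extend (frag_of \<circ> f) (frag_extend (frag_of \<circ> g) a) = a"
    proof
      fix a assume a: "a \<in> frag_space S"
      show "frag_extend (frag_of \<circ> f) (frag_extend (frag_of \<circ> g) a) = a"
        unfolding frag_extend_frag_extend
        by (subst (2) frag_expansion, rule frag_extend_eqI[OF a]) (simp add: g)
    qed
  qed (auto intro!: frag_extend_in_frag_space simp: g)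
  then show ?thesis
    unfolding free_of_rank_def by blast
qed

lemma free_of_rank_bij_betw:
  assumes "finite J" and b: "bij_betw (frag_extend b) (frag_space J) A"
  shows "free_of_rank A (card J)"
proof -
  obtain b' where "bij_betw (frag_extend b') (frag_space {..<card J}) (frag_space J)"
    using free_of_rank_frag_space[OF assms(1)] unfolding free_of_rank_def by blast
  from bij_betw_frag_extend_comp[OF b this] b show ?thesis
    unfolding free_of_rank_def bij_betw_def by auto
qed

text \<open>Euclid's algorithm: an elementary change of basis replaces one of two nonzero values of the
  functional by a smaller one, until a single basis element has a nonzero value.\<close>

lemma free_of_rank_kernel_functional_aux:
  fixes W :: "'i \<Rightarrow> ('v \<Rightarrow>\<^sub>0 int)"
  assumes "finite I" "i0 \<in> I" "Poly_Mapping.lookup (W i0) t \<noteq> 0"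
  shows "\<exists>J b. J \<subseteq> I \<and> Suc (card J) = card I \<and>
    bij_betw (frag_extend b) (frag_space J)
      {c \<in> frag_space I. Poly_Mapping.lookup (frag_extend W c) t = 0}"
  using assms(2,3)
proof (induction "\<Sum>i\<in>I. nat \<bar>Poly_Mapping.lookup (W i) t\<bar>" arbitrary: W i0 rule: less_induct)
  case less
  define m where "m = (\<lambda>(W :: 'i \<Rightarrow> 'v \<Rightarrow>\<^sub>0 int) i. Poly_Mapping.lookup (W i) t)"
  show ?case
  proof (cases "\<exists>j\<in>I - {i0}. m W j \<noteq> 0")
    case False
    have id: "frag_extend frag_of = (\<lambda>c :: 'i \<Rightarrow>\<^sub>0 int. c)"
      by (auto simp flip: frag_expansion)
    have "Poly_Mapping.lookup (frag_extend W c) t = Poly_Mapping.lookup c i0 * m W i0"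
      if "c \<in> frag_space I" for c
      using that by (induction c rule: frag_space_induct)
        (use False in \<open>auto simp: frag_extend_diff lookup_minus m_def left_diff_distrib\<close>)
    then have "{c \<in> frag_space I. Poly_Mapping.lookup (frag_extend W c) t = 0} =
        frag_space (I - {i0})"
      using less.prems by (auto simp: m_def frag_space_def in_keys_iff subset_iff)
    then show ?thesis
      using less.prems assms(1) card_Suc_Diff1[of I i0]
      by (intro exI[of _ "I - {i0}"] exI[of _ frag_of]) (simp add: id bij_betw_def)
  next
    case True
    \<comment> \<open>The indices are named so that the value at i is the larger one in absolute
      value.\<close>
    then obtain i j where ij: "i \<in> I" "j \<in> I" "i \<noteq> j" "m W j \<noteq> 0" "\<bar>m W j\<bar> \<le> \<bar>m W i\<bar>"
      using less.prems by (metis DiffD1 DiffD2 insertCI linorder_linear m_def)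
    \<comment> \<open>With this sign the new value at i has absolute value
      \<open>|m W i| - |m W j|\<close>, whatever the signs. The value at j is untouched, so j serves
      as the nonvanishing index in the recursive call.\<close>
    define s where "s = sgn (m W i) * sgn (m W j)"
    define W' where "W' = W(i := W i - frag_cmul s (W j))"
    have mi: "m W' i = m W i - s * m W j"
      by (simp add: m_def W'_def lookup_minus)
    have small: "\<bar>m W' i\<bar> < \<bar>m W i\<bar>"
      using ij(4,5) unfolding mi s_def
      by (cases "m W i" "0 :: int" rule: linorder_cases; cases "m W j" "0 :: int" rule: linorder_cases) auto
    have less': "(\<Sum>i\<in>I. nat \<bar>m W' i\<bar>) < (\<Sum>i\<in>I. nat \<bar>m W i\<bar>)"
      using small ij assms(1) by (intro sum_strict_mono_ex1) (auto simp: m_def W'_def)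
    have mj: "m W' j \<noteq> 0" using ij by (simp add: m_def W'_def)
    obtain J b where J: "J \<subseteq> I" "Suc (card J) = card I"
      and b: "bij_betw (frag_extend b) (frag_space J)
        {c \<in> frag_space I. Poly_Mapping.lookup (frag_extend W' c) t = 0}"
      using less.hyps[OF less'[unfolded m_def] ij(2) mj[unfolded m_def]] by blast
    \<comment> \<open>The elementary change of basis behind \<open>W'\<close>; its inverse has the
      opposite coefficient. It carries the kernel of the new functional onto the kernel of the old
      one.\<close>
    define \<theta> where "\<theta> = (\<lambda>r k. if k = i then frag_of i - frag_cmul r (frag_of j) else frag_of k)"
    have inv: "frag_extend (\<theta> (- r)) (frag_extend (\<theta> r) c) = c" for r c
    proof -
      have "frag_extend (\<theta> (- r)) \<circ> \<theta> r = frag_of"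
        using ij(3) by (auto simp: \<theta>_def fun_eq_iff frag_extend_diff frag_extend_cmul frag_cmul_diff_distrib simp del: minus_frag_cmul)
          (auto simp: poly_mapping_eqI lookup_add lookup_minus)
      then show ?thesis by (simp add: frag_extend_frag_extend flip: frag_expansion)
    qed
    have in_I: "frag_extend (\<theta> r) c \<in> frag_space I" if "c \<in> frag_space I" for r c
      using that ij by (auto simp: \<theta>_def intro!: frag_extend_in_frag_space frag_space_intros)
    have \<theta>: "bij_betw (frag_extend (\<theta> s)) (frag_space I) (frag_space I)"
      using inv[of s] inv[of "- s"] in_I
      by (intro bij_betw_byWitness[where f' = "frag_extend (\<theta> (- s))"]) auto
    have W': "frag_extend W' c = frag_extend W (frag_extend (\<theta> s) c)" for c
    proof -
      have "W' = frag_extend W \<circ> \<theta> s"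
        by (auto simp: W'_def \<theta>_def fun_eq_iff frag_extend_diff frag_extend_cmul)
      then show ?thesis by (simp add: frag_extend_frag_extend)
    qed
    have "frag_extend (\<theta> s) ` {c \<in> frag_space I. Poly_Mapping.lookup (frag_extend W' c) t = 0}
        = {c \<in> frag_space I. Poly_Mapping.lookup (frag_extend W c) t = 0}"
      (is "?f ` ?A = ?B")
    proof
      show "?f ` ?A \<subseteq> ?B" using in_I by (auto simp: W')
      show "?B \<subseteq> ?f ` ?A"
      proof
        fix c assume "c \<in> ?B"
        then show "c \<in> ?f ` ?A"
          using in_I[of c "- s"] inv[of "- s" c]
          by (intro image_eqI[of _ _ "frag_extend (\<theta> (- s)) c"]) (auto simp: W')
      qed
    qed
    then show ?thesis
      using bij_betw_frag_extend_comp[OF \<theta> b] J by auto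
  qed
qed

text \<open>The functional is written as a coordinate t of a map between free groups, so that
  \<open>frag_extend\<close> supplies its linearity. Read in a basis of A, it must be nonzero on
  some basis vector, and the Euclidean reduction applies.\<close>

lemma free_of_rank_kernel_functional:
  fixes W :: "'a \<Rightarrow> ('v \<Rightarrow>\<^sub>0 int)"
  assumes A: "free_of_rank A n" and x: "x \<in> A" "Poly_Mapping.lookup (frag_extend W x) t \<noteq> 0"
  obtains k where "n = Suc k"
    "free_of_rank {c \<in> A. Poly_Mapping.lookup (frag_extend W c) t = 0} k"
proof -
  define I where "I = {..<n}"
  have I: "finite I" "card I = n"
    by (auto simp: I_def)
  obtain b where b: "bij_betw (frag_extend b) (frag_space I) A"
    using A unfolding free_of_rank_def I_def by blast
  let ?W = "frag_extend W \<circ> b"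
  have "\<exists>i\<in>I. Poly_Mapping.lookup (?W i) t \<noteq> 0"
  proof (rule ccontr)
    assume *: "\<not> ?thesis"
    have "Poly_Mapping.lookup (frag_extend ?W c) t = 0" if "c \<in> frag_space I" for c
      using that by (induction c rule: frag_space_induct)
        (use * in \<open>auto simp: frag_extend_diff lookup_minus\<close>)
    then show False
      using x b by (auto simp: bij_betw_def frag_extend_frag_extend)
  qed
  then obtain i where "i \<in> I" "Poly_Mapping.lookup (?W i) t \<noteq> 0" ..
  from free_of_rank_kernel_functional_aux[where W = ?W, OF I(1) this] obtain J b'
    where J: "J \<subseteq> I" "Suc (card J) = card I"
    and b': "bij_betw (frag_extend b') (frag_space J)
      {c \<in> frag_space I. Poly_Mapping.lookup (frag_extend ?W c) t = 0}"
    by blast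
  have "frag_extend b ` {c \<in> frag_space I. Poly_Mapping.lookup (frag_extend ?W c) t = 0}
      = {c \<in> A. Poly_Mapping.lookup (frag_extend W c) t = 0}"
    using b by (auto simp: bij_betw_def frag_extend_frag_extend)
  moreover have "bij_betw (frag_extend (frag_extend b \<circ> b')) (frag_space J)
      (frag_extend b ` {c \<in> frag_space I. Poly_Mapping.lookup (frag_extend ?W c) t = 0})"
    by (rule bij_betw_frag_extend_comp[OF b b']) auto
  ultimately have "free_of_rank {c \<in> A. Poly_Mapping.lookup (frag_extend W c) t = 0} (card J)"
    using free_of_rank_bij_betw[OF finite_subset[OF J(1) I(1)]] by metis
  with J I show thesis by (intro that[of "card J"]) auto
qed

text \<open>The hypothesis is a form of linear independence of the coordinates. The vector x for t
  lies in the common kernel of the other coordinates, so the functional t is nonzero there, and each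
  new coordinate lowers the rank by exactly one.\<close>

lemma free_of_rank_kernel_coordinates:
  fixes W :: "'a \<Rightarrow> ('v \<Rightarrow>\<^sub>0 int)"
  assumes "finite S" "finite T"
    and "\<And>t. t \<in> T \<Longrightarrow> \<exists>x \<in> frag_space S. Poly_Mapping.lookup (frag_extend W x) t \<noteq> 0 \<and>
          (\<forall>u \<in> T - {t}. Poly_Mapping.lookup (frag_extend W x) u = 0)"
  shows "\<exists>k. k + card T = card S \<and>
    free_of_rank {c \<in> frag_space S. \<forall>t \<in> T. Poly_Mapping.lookup (frag_extend W c) t = 0} k"
  using assms(2,3)
proof (induction T rule: finite_induct)
  case empty
  then show ?case using free_of_rank_frag_space[OF assms(1)] by auto
next
  case (insert t T)
  have "\<exists>k. k + card T = card S \<and>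
      free_of_rank {c \<in> frag_space S. \<forall>t \<in> T. Poly_Mapping.lookup (frag_extend W c) t = 0} k"
  proof (rule insert.IH)
    fix u assume "u \<in> T"
    then show "\<exists>x \<in> frag_space S. Poly_Mapping.lookup (frag_extend W x) u \<noteq> 0 \<and>
          (\<forall>v \<in> T - {u}. Poly_Mapping.lookup (frag_extend W x) v = 0)"
      using insert.prems[of u] by blast
  qed
  then obtain k where k: "k + card T = card S"
    "free_of_rank {c \<in> frag_space S. \<forall>t \<in> T. Poly_Mapping.lookup (frag_extend W c) t = 0} k"
    by blast
  obtain x where x: "x \<in> frag_space S" "Poly_Mapping.lookup (frag_extend W x) t \<noteq> 0"
     "\<forall>u \<in> T. Poly_Mapping.lookup (frag_extend W x) u = 0"
    using insert.prems[of t] insert.hyps by auto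
  have "x \<in> {c \<in> frag_space S. \<forall>t \<in> T. Poly_Mapping.lookup (frag_extend W c) t = 0}"
    using x by simp
  from free_of_rank_kernel_functional[OF k(2) this x(2)] obtain l where l: "k = Suc l"
    "free_of_rank {c \<in> {c \<in> frag_space S. \<forall>t \<in> T. Poly_Mapping.lookup (frag_extend W c) t = 0}.
        Poly_Mapping.lookup (frag_extend W c) t = 0} l" .
  have "{c \<in> {c \<in> frag_space S. \<forall>t \<in> T. Poly_Mapping.lookup (frag_extend W c) t = 0}.
        Poly_Mapping.lookup (frag_extend W c) t = 0} =
      {c \<in> frag_space S. \<forall>t \<in> insert t T. Poly_Mapping.lookup (frag_extend W c) t = 0}"
    by auto
  with l k insert.hyps show ?case by auto
qed

section \<open>Isomorphisms with powers of the integers\<close>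

lemma Mod_kernel_iso:
  assumes "group G" "group H" "h \<in> hom G H" "h ` carrier G = carrier H" "kernel G H h = N"
  shows "G Mod N \<cong> H"
proof -
  interpret group_hom G H h
    using assms by (simp add: group_hom_def group_hom_axioms_def)
  show ?thesis using FactGroup_iso assms by auto
qed

lemma group_int_power [simp]: "group (int_power n)"
  by (simp add: int_power_def)

lemma free_Abelian_group_iso_int_power: "free_Abelian_group {..<n} \<cong> int_power n"
proof -
  let ?h = "\<lambda>x. \<lambda>i\<in>{..<n}. Poly_Mapping.lookup x i"
  have "?h \<in> iso (free_Abelian_group {..<n}) (int_power n)"
  proof (rule isoI)
    show "?h \<in> hom (free_Abelian_group {..<n}) (int_power n)"
      by (rule homI) (auto simp: int_power_def lookup_add)
    show "bij_betw ?h (carrier (free_Abelian_group {..<n})) (carrier (int_power n))"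
    proof (rule bij_betw_imageI)
      show "inj_on ?h (carrier (free_Abelian_group {..<n}))"
      proof (rule inj_onI)
        fix x y assume *: "x \<in> carrier (free_Abelian_group {..<n})"
          "y \<in> carrier (free_Abelian_group {..<n})" "?h x = ?h y"
        show "x = y"
        proof (rule poly_mapping_eqI)
          fix i
          show "Poly_Mapping.lookup x i = Poly_Mapping.lookup y i"
          proof (cases "i < n")
            case True
            then show ?thesis using fun_cong[OF *(3), of i] by simp
          next
            case False
            then show ?thesis using * by (metis carrier_free_Abelian_group_iff in_keys_iff lessThan_iff subsetD)
          qed
        qed
      qed
      show "?h ` carrier (free_Abelian_group {..<n}) = carrier (int_power n)"
      proof
        show "?h ` carrier (free_Abelian_group {..<n}) \<subseteq> carrier (int_power n)"
          by (auto simp: int_power_def split: if_splits)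
        show "carrier (int_power n) \<subseteq> ?h ` carrier (free_Abelian_group {..<n})"
        proof
          fix c assume c: "c \<in> carrier (int_power n)"
          let ?x = "\<Sum>i<n. frag_cmul (c i) (frag_of i)"
          have "?x \<in> frag_space {..<n}"
            by (rule sum_in_frag_space) auto
          moreover have "c = ?h ?x"
          proof
            fix i show "c i = ?h ?x i"
              using c by (auto simp: int_power_def lookup_sum if_distrib sum.delta' PiE_def extensional_def cong: if_cong)
          qed
          ultimately show "c \<in> ?h ` carrier (free_Abelian_group {..<n})"
            unfolding carrier_free_Abelian_group by blast
        qed
      qed
    qed
  qed
  then show ?thesis by (auto simp: is_iso_def)
qed

lemma free_of_rank_iso_int_power:
  assumes A: "subgroup A (free_Abelian_group S)" and "free_of_rank A n"
  shows "subgroup_generated (free_Abelian_group S) A \<cong> int_power n"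
proof -
  obtain b :: "nat \<Rightarrow> 'a \<Rightarrow>\<^sub>0 int" where b: "bij_betw (frag_extend b) (frag_space {..<n}) A"
    using assms(2) by (auto simp: free_of_rank_def)
  have c: "carrier (subgroup_generated (free_Abelian_group S) A) = A"
    using A by (rule subgroup.carrier_subgroup_generated_subgroup)
  have "frag_extend b \<in> iso (free_Abelian_group {..<n}) (subgroup_generated (free_Abelian_group S) A)"
    using b unfolding iso_def hom_def c carrier_free_Abelian_group
    by (auto simp: bij_betw_def frag_extend_add)
  then have "free_Abelian_group {..<n} \<cong> subgroup_generated (free_Abelian_group S) A"
    by (auto simp: is_iso_def)
  then show ?thesis
    using free_Abelian_group_iso_int_power iso_trans group.iso_sym group_free_Abelian_group by blast
qed

section \<open>Direct products and split exact sequences\<close>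

lemma DirProd_integer_int_power: "integer_group \<times>\<times> int_power n \<cong> int_power (Suc n)"
proof -
  let ?h = "\<lambda>(a, c). \<lambda>i\<in>{..<Suc n}. if i = n then a else c i"
  let ?h' = "\<lambda>c. (c n, restrict c {..<n})"
  have "?h \<in> iso (integer_group \<times>\<times> int_power n) (int_power (Suc n))"
  proof (rule isoI)
    show "?h \<in> hom (integer_group \<times>\<times> int_power n) (int_power (Suc n))"
    proof (rule homI)
      fix x y assume "x \<in> carrier (integer_group \<times>\<times> int_power n)"
        "y \<in> carrier (integer_group \<times>\<times> int_power n)"
      show "?h (x \<otimes>\<^bsub>integer_group \<times>\<times> int_power n\<^esub> y) = ?h x \<otimes>\<^bsub>int_power (Suc n)\<^esub> ?h y"
        by (cases x; cases y) (simp add: int_power_def restrict_def fun_eq_iff)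
    qed (auto simp: int_power_def PiE_def split: prod.splits)
    show "bij_betw ?h (carrier (integer_group \<times>\<times> int_power n)) (carrier (int_power (Suc n)))"
    proof (rule bij_betw_byWitness[where f' = ?h'])
      have "restrict (\<lambda>i\<in>{..<Suc n}. if i = n then a else c i) {..<n} = c"
        if "c \<in> carrier (int_power n)" for a c
        using that by (intro ext) (auto simp: int_power_def PiE_def extensional_def restrict_def)
      then show "\<forall>x\<in>carrier (integer_group \<times>\<times> int_power n). ?h' (?h x) = x"
        by (auto simp: restrict_apply' simp del: restrict_apply)
      have "(\<lambda>i\<in>{..<Suc n}. if i = n then c n else restrict c {..<n} i) = c"
        if "c \<in> carrier (int_power (Suc n))" for c
        using that by (intro ext) (auto simp: int_power_def PiE_def extensional_def restrict_def)
      then show "\<forall>c\<in>carrier (int_power (Suc n)). ?h (?h' c) = c"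
        by simp
      show "?h ` carrier (integer_group \<times>\<times> int_power n) \<subseteq> carrier (int_power (Suc n))"
        by (auto simp: int_power_def PiE_def split: if_splits)
      show "?h' ` carrier (int_power (Suc n)) \<subseteq> carrier (integer_group \<times>\<times> int_power n)"
        by (auto simp: int_power_def PiE_def split: if_splits)
    qed
  qed
  then show ?thesis by (auto simp: is_iso_def)
qed

lemma DirProd_trivial_group:
  assumes "group G" "group K" "trivial_group G"
  shows "G \<times>\<times> K \<cong> K"
proof -
  have "snd \<in> iso (G \<times>\<times> K) K"
    using assms(3) by (auto simp: iso_def hom_def trivial_group_def bij_betw_def inj_on_def image_iff)
  then show ?thesis by (auto simp: is_iso_def)
qed

lemma DirProd_short_exact:
  assumes "group G" "group K" "group H" "H \<cong> G \<times>\<times> K"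
  obtains f g where "f \<in> mon K H" "g \<in> epi H G" "f ` carrier K = kernel H G g"
proof -
  obtain h where h: "h \<in> iso H (G \<times>\<times> K)"
    using assms(4) by (auto simp: is_iso_def)
  let ?k = "inv_into (carrier H) h"
  have k: "?k \<in> iso (G \<times>\<times> K) H"
    using group.iso_set_sym[OF assms(3) h] .
  let ?f = "\<lambda>x. ?k (\<one>\<^bsub>G\<^esub>, x)" and ?g = "\<lambda>y. fst (h y)"
  have bij: "bij_betw h (carrier H) (carrier G \<times> carrier K)"
    and hom_h: "h \<in> hom H (G \<times>\<times> K)" and hom_k: "?k \<in> hom (G \<times>\<times> K) H"
    and bijk: "bij_betw ?k (carrier G \<times> carrier K) (carrier H)"
    using h k by (auto simp: iso_def)
  have hk: "h (?k z) = z" if "z \<in> carrier G \<times> carrier K" for z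
    using bij that by (simp add: bij_betw_inv_into_right)
  have kh: "?k (h y) = y" if "y \<in> carrier H" for y
    using bij that by (simp add: bij_betw_inv_into_left)
  have one: "\<one>\<^bsub>G\<^esub> \<in> carrier G" and one1: "\<one>\<^bsub>G\<^esub> \<otimes>\<^bsub>G\<^esub> \<one>\<^bsub>G\<^esub> = \<one>\<^bsub>G\<^esub>"
    using assms(1) by (simp_all add: group.is_monoid)
  have kin: "?k (\<one>\<^bsub>G\<^esub>, x) \<in> carrier H" if "x \<in> carrier K" for x
    using that one hom_in_carrier[OF hom_k] by auto
  show thesis
  proof (rule that[of ?f ?g])
    show "?f \<in> mon K H"
    proof -
      have "?f \<in> hom K H"
      proof (rule homI)
        fix x y assume xy: "x \<in> carrier K" "y \<in> carrier K"
        show "?f (x \<otimes>\<^bsub>K\<^esub> y) = ?f x \<otimes>\<^bsub>H\<^esub> ?f y"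
          using hom_mult[OF hom_k, of "(\<one>\<^bsub>G\<^esub>, x)" "(\<one>\<^bsub>G\<^esub>, y)"] xy one one1 by simp
      qed (rule kin)
      moreover have "inj_on ?f (carrier K)"
        using one by (intro inj_onI) (metis SigmaI hk prod.inject)
      ultimately show ?thesis by (simp add: mon_def)
    qed
    show "?g \<in> epi H G"
    proof -
      have "?g \<in> hom H G"
      proof (rule homI)
        fix x assume "x \<in> carrier H"
        then show "?g x \<in> carrier G" using hom_in_carrier[OF hom_h] by fastforce
      next
        fix x y assume xy: "x \<in> carrier H" "y \<in> carrier H"
        show "?g (x \<otimes>\<^bsub>H\<^esub> y) = ?g x \<otimes>\<^bsub>G\<^esub> ?g y"
          using hom_mult[OF hom_h xy] by (cases "h x"; cases "h y") simp
      qed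
      moreover have "carrier G \<subseteq> ?g ` carrier H"
      proof
        fix x assume x: "x \<in> carrier G"
        have K1: "\<one>\<^bsub>K\<^esub> \<in> carrier K" using assms(2) by (simp add: group.is_monoid)
        show "x \<in> ?g ` carrier H"
          using x K1 hk[of "(x, \<one>\<^bsub>K\<^esub>)"] bijk
          by (intro image_eqI[of _ _ "?k (x, \<one>\<^bsub>K\<^esub>)"]) (auto simp: bij_betw_def)
      qed
      ultimately show ?thesis by (simp add: epi_iff_subset)
    qed
    show "?f ` carrier K = kernel H G ?g"
    proof
      show "?f ` carrier K \<subseteq> kernel H G ?g"
        using kin hk one by (auto simp: kernel_def)
      show "kernel H G ?g \<subseteq> ?f ` carrier K"
      proof
        fix y assume y: "y \<in> kernel H G ?g"
        then have yH: "y \<in> carrier H" and "fst (h y) = \<one>\<^bsub>G\<^esub>" by (auto simp: kernel_def)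
        then have "?f (snd (h y)) = y"
          by (metis kh prod.collapse)
        moreover have "snd (h y) \<in> carrier K"
          using hom_in_carrier[OF hom_h yH] by auto
        ultimately show "y \<in> ?f ` carrier K" by (metis imageI)
      qed
    qed
  qed
qed

section \<open>Low-dimensional chains\<close>

declare One_nat_def [simp del]

lemma simplices_1: "simplices C 1 = {Tuple [x] |x. x \<in> cat_mor C}"
  by (auto simp: simplices_def composable_def length_Suc_conv One_nat_def)

lemma simplices_2: "simplices C 2 =
    {Tuple [x, y] |x y. x \<in> cat_mor C \<and> y \<in> cat_mor C \<and> cat_dom C x = cat_cod C y}"
  by (auto simp: simplices_def composable_def length_Suc_conv numeral_2_eq_2 less_Suc_eq One_nat_def)

lemma simplices_3: "simplices C 3 =
    {Tuple [x, y, z] |x y z. x \<in> cat_mor C \<and> y \<in> cat_mor C \<and> z \<in> cat_mor C \<and>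
      cat_dom C x = cat_cod C y \<and> cat_dom C y = cat_cod C z}"
  by (auto simp: simplices_def composable_def length_Suc_conv numeral_3_eq_3 less_Suc_eq One_nat_def)

lemma Tuple_in_simplices [simp]:
  "Tuple [x] \<in> simplices C 1 \<longleftrightarrow> x \<in> cat_mor C"
  "Tuple [x, y] \<in> simplices C 2 \<longleftrightarrow>
     x \<in> cat_mor C \<and> y \<in> cat_mor C \<and> cat_dom C x = cat_cod C y"
  "Tuple [x, y, z] \<in> simplices C 3 \<longleftrightarrow> x \<in> cat_mor C \<and> y \<in> cat_mor C \<and> z \<in> cat_mor C \<and>
     cat_dom C x = cat_cod C y \<and> cat_dom C y = cat_cod C z"
  unfolding simplices_1 simplices_2 simplices_3 by blast+

lemma frag_cmul_diff2: "frag_cmul k (a - b) = frag_cmul k a - frag_cmul k b"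
  by (simp add: poly_mapping_eqI lookup_minus right_diff_distrib)

lemma cat_boundary_0: "cat_boundary C 0 (frag_of (Tuple [x])) =
    frag_of (Vertex (cat_dom C x)) - frag_of (Vertex (cat_cod C x))"
  by (simp add: cat_boundary_def)

lemma cat_boundary_1: "cat_boundary C 1 (frag_of (Tuple [x, y])) =
    frag_of (Tuple [y]) - frag_of (Tuple [cat_comp C x y]) + frag_of (Tuple [x])"
  by (simp add: cat_boundary_def merge_at_def One_nat_def)

lemma cat_boundary_2: "cat_boundary C 2 (frag_of (Tuple [x, y, z])) =
    frag_of (Tuple [y, z]) - frag_of (Tuple [cat_comp C x y, z])
      + frag_of (Tuple [x, cat_comp C y z]) - frag_of (Tuple [x, y])"
  by (simp add: cat_boundary_def merge_at_def numeral_2_eq_2 One_nat_def)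

lemma cat_boundary_simps:
  "cat_boundary C k 0 = 0"
  "cat_boundary C k (a + b) = cat_boundary C k a + cat_boundary C k b"
  "cat_boundary C k (a - b) = cat_boundary C k a - cat_boundary C k b"
  "cat_boundary C k (- a) = - cat_boundary C k a"
  "cat_boundary C k (frag_cmul n a) = frag_cmul n (cat_boundary C k a)"
  by (simp_all add: cat_boundary_def frag_extend_add frag_extend_diff frag_extend_minus frag_extend_cmul)

section \<open>Working modulo boundaries\<close>

definition boundaries :: "('o, 'm) category \<Rightarrow> nat \<Rightarrow> (('o, 'm) simplex \<Rightarrow>\<^sub>0 int) set" where
  "boundaries C k = cat_boundary C k ` frag_space (simplices C (Suc k))"

lemma boundariesI: "c \<in> frag_space (simplices C (Suc k)) \<Longrightarrow> cat_boundary C k c \<in> boundaries C k"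
  by (simp add: boundaries_def)

lemma boundaries_closed:
  shows boundaries_0: "0 \<in> boundaries C k"
    and boundaries_diff: "a \<in> boundaries C k \<Longrightarrow> b \<in> boundaries C k \<Longrightarrow> a - b \<in> boundaries C k"
    and boundaries_add: "a \<in> boundaries C k \<Longrightarrow> b \<in> boundaries C k \<Longrightarrow> a + b \<in> boundaries C k"
    and boundaries_minus: "a \<in> boundaries C k \<Longrightarrow> - a \<in> boundaries C k"
  unfolding boundaries_def
  by (auto simp flip: cat_boundary_simps intro!: image_eqI[OF refl] frag_space_intros)
    (auto simp: cat_boundary_simps intro: image_eqI[where x = 0])

lemma boundaries_3_out_of_4:
  assumes "a - b + c - d \<in> boundaries C k"
  shows "b \<in> boundaries C k \<Longrightarrow> c \<in> boundaries C k \<Longrightarrow> d \<in> boundaries C k \<Longrightarrow> a \<in> boundaries C k"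
    and "a \<in> boundaries C k \<Longrightarrow> c \<in> boundaries C k \<Longrightarrow> d \<in> boundaries C k \<Longrightarrow> b \<in> boundaries C k"
    and "a \<in> boundaries C k \<Longrightarrow> b \<in> boundaries C k \<Longrightarrow> d \<in> boundaries C k \<Longrightarrow> c \<in> boundaries C k"
    and "a \<in> boundaries C k \<Longrightarrow> b \<in> boundaries C k \<Longrightarrow> c \<in> boundaries C k \<Longrightarrow> d \<in> boundaries C k"
proof -
  note closed = boundaries_add[of _ C k] boundaries_diff[of _ C k]
  show "b \<in> boundaries C k \<Longrightarrow> c \<in> boundaries C k \<Longrightarrow> d \<in> boundaries C k \<Longrightarrow> a \<in> boundaries C k"
    using closed(1)[OF closed(2)[OF closed(1)[OF assms, of b], of c], of d] by simp
  show "a \<in> boundaries C k \<Longrightarrow> c \<in> boundaries C k \<Longrightarrow> d \<in> boundaries C k \<Longrightarrow> b \<in> boundaries C k"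
    using closed(2)[OF closed(1)[OF _ closed(2)[of c d]] assms, of a] by simp
  show "a \<in> boundaries C k \<Longrightarrow> b \<in> boundaries C k \<Longrightarrow> d \<in> boundaries C k \<Longrightarrow> c \<in> boundaries C k"
    using closed(1)[OF closed(2)[OF closed(1)[OF assms, of b], of a], of d] by simp
  show "a \<in> boundaries C k \<Longrightarrow> b \<in> boundaries C k \<Longrightarrow> c \<in> boundaries C k \<Longrightarrow> d \<in> boundaries C k"
    using closed(2)[OF closed(1)[OF closed(2)[of a b], of c] assms] by simp
qed

text \<open>Moving \<open>g^a\<close> past (e, i) uses the relation \<open>g^p e = e g\<close>
  exactly \<open>(a + i) div p(e)\<close> times, and that quotient is the exponent met by the next
  edge. The value records these numbers of uses as a chain of edges.\<close>

fun odometer_carries :: "('e \<Rightarrow> nat) \<Rightarrow> int \<Rightarrow> ('e \<times> int) list \<Rightarrow> ('e \<Rightarrow>\<^sub>0 int)" where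
  "odometer_carries p a [] = 0"
| "odometer_carries p a ((e, i) # \<xi>) = frag_cmul ((a + i) div int (p e)) (frag_of e)
     + odometer_carries p ((a + i) div int (p e)) \<xi>"

lemma odometer_carries_append:
  "odometer_carries p a (\<xi> @ \<eta>) =
     odometer_carries p a \<xi> + odometer_carries p (odometer_carry p a \<xi>) \<eta>"
  by (induction p a \<xi> rule: odometer_move.induct) simp_all

text \<open>The crossed rule of \<open>odometer_carry\<close> holds digit by digit. Together with
  the rule for concatenated paths it makes the carry count a 2-cocycle.\<close>

lemma odometer_carries_add:
  "odometer_carries p (a + b) \<xi> =
     odometer_carries p a (odometer_move p b \<xi>) + odometer_carries p b \<xi>"
  by (induction p b \<xi> arbitrary: a rule: odometer_move.induct)
    (simp_all add: odometer_div_mod frag_cmul_distrib)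

section \<open>The category of an odometer\<close>

locale odometer = wf_digraph E for E :: "('v, 'e) pre_digraph" +
  fixes p :: "'e \<Rightarrow> nat"
  assumes p_pos: "e \<in> arcs E \<Longrightarrow> 0 < p e"
begin

abbreviation "F \<equiv> odometer_graph E p"

definition "X = zappa_szep (integer_bundle (verts E)) (path_category F) (odometer_lact p) (odometer_ract E p)"

definition src :: "'v \<Rightarrow> ('e \<times> int) list \<Rightarrow> 'v" where
  "src v \<xi> = path_source F (v, \<xi>)"

lemma F_simps [simp]:
  "verts F = verts E" "tail F (e, i) = tail E e" "head F (e, i) = head E e"
  "(e, i) \<in> arcs F \<longleftrightarrow> e \<in> arcs E \<and> 0 \<le> i \<and> i < int (p e)"
  by (simp_all add: odometer_graph_def)

lemma src_simps [simp]:
  "src v [] = v"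
  "src v ((e, i) # \<xi>) = src (tail E e) \<xi>"
  "src v (\<xi> @ \<eta>) = src (src v \<xi>) \<eta>"
  "src v (odometer_move p a \<xi>) = src v \<xi>"
  by (simp_all add: src_def path_source_Cons path_source_append path_source_odometer_move)

lemma wf_F: "wf_digraph F"
  by (rule wf_odometer_graph) (rule wf_digraph_axioms)

lemma src_in_verts: "is_path F v \<xi> \<Longrightarrow> src v \<xi> \<in> verts E"
  using is_path_source[OF wf_F] by (simp add: src_def)

lemma is_path_F_move: "is_path F v \<xi> \<Longrightarrow> is_path F v (odometer_move p a \<xi>)"
  by (rule is_path_odometer_move[OF _ p_pos])

lemma is_path_F_append: "is_path F v (\<xi> @ \<eta>) \<longleftrightarrow> is_path F v \<xi> \<and> is_path F (src v \<xi>) \<eta>"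
  using is_path_append[OF wf_F] by (simp add: src_def)

definition mor :: "'v \<Rightarrow> ('e \<times> int) list \<Rightarrow> int \<Rightarrow> ('v \<times> ('e \<times> int) list) \<times> ('v \<times> int)" where
  "mor v \<xi> a = ((v, \<xi>), (src v \<xi>, a))"

lemma cat_mor_X: "cat_mor X =
    {((v, \<xi>), (w, a)) |v \<xi> w a. is_path F v \<xi> \<and> w = src v \<xi> \<and> w \<in> verts E}"
  by (auto simp: X_def zappa_szep_def path_category_def paths_def integer_bundle_def src_def)

lemma mor_in_X [simp]: "mor v \<xi> a \<in> cat_mor X \<longleftrightarrow> is_path F v \<xi>"
  using src_in_verts[of v \<xi>] by (auto simp: mor_def cat_mor_X)

lemma mor_X_cases:
  assumes "x \<in> cat_mor X"
  obtains v \<xi> a where "x = mor v \<xi> a" "is_path F v \<xi>"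
  using assms by (auto simp: mor_def cat_mor_X)

lemma obj_X [simp]: "cat_obj X = verts E"
  by (simp add: X_def zappa_szep_def integer_bundle_def)

lemma cod_mor [simp]: "cat_cod X (mor v \<xi> a) = v" and dom_mor [simp]: "cat_dom X (mor v \<xi> a) = src v \<xi>"
  by (simp_all add: mor_def X_def zappa_szep_def path_category_def path_range_def integer_bundle_def)

lemma comp_mor [simp]: "w = src v \<xi> \<Longrightarrow> cat_comp X (mor v \<xi> a) (mor w \<eta> b) =
    mor v (\<xi> @ odometer_move p a \<eta>) (odometer_carry p a \<eta> + b)"
  unfolding mor_def src_simps by (simp add: src_def X_def zappa_szep_def path_category_def integer_bundle_def
      odometer_lact_def odometer_ract_def)

abbreviation chain1 ::
    "('v \<times> ('e \<times> int) list) \<times> ('v \<times> int) \<Rightarrow> ('v, ('v \<times> ('e \<times> int) list) \<times> ('v \<times> int)) simplex \<Rightarrow>\<^sub>0 int" where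
  "chain1 x \<equiv> frag_of (Tuple [x])"
abbreviation chain2 ::
    "('v \<times> ('e \<times> int) list) \<times> ('v \<times> int) \<Rightarrow> ('v \<times> ('e \<times> int) list) \<times> ('v \<times> int) \<Rightarrow>
      ('v, ('v \<times> ('e \<times> int) list) \<times> ('v \<times> int)) simplex \<Rightarrow>\<^sub>0 int" where
  "chain2 x y \<equiv> frag_of (Tuple [x, y])"
abbreviation "C k \<equiv> frag_space (simplices X k)"
abbreviation "d k \<equiv> cat_boundary X k"
abbreviation "B k \<equiv> boundaries X k"

section \<open>Low-dimensional simplices in coordinates\<close>

lemma simplices_X_1_cases:
  assumes "s \<in> simplices X 1"
  obtains v \<xi> a where "s = Tuple [mor v \<xi> a]" "is_path F v \<xi>"
  using assms unfolding simplices_1 by (blast elim: mor_X_cases)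

lemma simplices_X_2_cases:
  assumes "s \<in> simplices X 2"
  obtains v \<xi> a \<eta> b where "s = Tuple [mor v \<xi> a, mor (src v \<xi>) \<eta> b]" "is_path F v \<xi>" "is_path F (src v \<xi>) \<eta>"
proof -
  from assms obtain x y where "s = Tuple [x, y]" "x \<in> cat_mor X" "y \<in> cat_mor X" "cat_dom X x = cat_cod X y"
    unfolding simplices_2 by blast
  then show thesis
    by (elim mor_X_cases) (auto intro: that)
qed

lemma simplices_X_3_cases:
  assumes "s \<in> simplices X 3"
  obtains v \<xi> a \<eta> b \<zeta> c where
    "s = Tuple [mor v \<xi> a, mor (src v \<xi>) \<eta> b, mor (src (src v \<xi>) \<eta>) \<zeta> c]"
    "is_path F v \<xi>" "is_path F (src v \<xi>) \<eta>" "is_path F (src (src v \<xi>) \<eta>) \<zeta>"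
proof -
  from assms obtain x y z where "s = Tuple [x, y, z]" "x \<in> cat_mor X" "y \<in> cat_mor X" "z \<in> cat_mor X"
    "cat_dom X x = cat_cod X y" "cat_dom X y = cat_cod X z"
    unfolding simplices_3 by blast
  then show thesis
    by (elim mor_X_cases) (auto intro: that)
qed

lemma d_1_chain2: "w = src v \<xi> \<Longrightarrow> d 1 (chain2 (mor v \<xi> a) (mor w \<eta> b)) =
    chain1 (mor w \<eta> b) - chain1 (mor v (\<xi> @ odometer_move p a \<eta>) (odometer_carry p a \<eta> + b))
      + chain1 (mor v \<xi> a)"
  using cat_boundary_1[of X] by simp

text \<open>This is the boundary of the 3-simplex on the three morphisms. The later congruences
  modulo \<open>B 2\<close> are deduced from instances of it.\<close>

lemma B2_cocycle:
  assumes "is_path F v \<xi>" "is_path F (src v \<xi>) \<eta>" "is_path F (src (src v \<xi>) \<eta>) \<zeta>"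
  shows "chain2 (mor (src v \<xi>) \<eta> b) (mor (src (src v \<xi>) \<eta>) \<zeta> c)
    - chain2 (mor v (\<xi> @ odometer_move p a \<eta>) (odometer_carry p a \<eta> + b)) (mor (src (src v \<xi>) \<eta>) \<zeta> c)
    + chain2 (mor v \<xi> a) (mor (src v \<xi>) (\<eta> @ odometer_move p b \<zeta>) (odometer_carry p b \<zeta> + c))
    - chain2 (mor v \<xi> a) (mor (src v \<xi>) \<eta> b) \<in> B 2" (is "?c \<in> _")
proof -
  have "d 2 (frag_of (Tuple [mor v \<xi> a, mor (src v \<xi>) \<eta> b, mor (src (src v \<xi>) \<eta>) \<zeta> c])) = ?c"
    by (simp add: cat_boundary_2)
  moreover have "frag_of (Tuple [mor v \<xi> a, mor (src v \<xi>) \<eta> b, mor (src (src v \<xi>) \<eta>) \<zeta> c]) \<in> C (Suc 2)"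
    using assms by (simp flip: eval_nat_numeral(3))
  ultimately show ?thesis using boundariesI by metis
qed

definition gen :: "'v \<Rightarrow> int \<Rightarrow> ('v \<times> ('e \<times> int) list) \<times> ('v \<times> int)" where
  "gen v a = mor v [] a"

definition edge :: "'e \<Rightarrow> int \<Rightarrow> ('v \<times> ('e \<times> int) list) \<times> ('v \<times> int)" where
  "edge e i = mor (head E e) [(e, i)] 0"

text \<open>The complex is not normalised: the constant term makes the boundary formula below hold for the
  identity \<open>a = 0\<close>.\<close>

definition hpow :: "'v \<Rightarrow> int \<Rightarrow> _" where
  "hpow v a = chain2 (gen v 0) (gen v 0) - (\<Sum>j\<in>{0..<a}. chain2 (gen v j) (gen v 1))
     + (\<Sum>j\<in>{a..<0}. chain2 (gen v j) (gen v 1))"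

lemma hpow_0: "hpow v 0 = chain2 (gen v 0) (gen v 0)"
  by (simp add: hpow_def)

text \<open>One recursion for both signs of the exponent, so that inductions over the integers need
  not split \<open>hpow\<close> into cases.\<close>

lemma hpow_add_1: "hpow v (a + 1) = hpow v a - chain2 (gen v a) (gen v 1)"
proof (cases "a \<ge> 0")
  case True
  then have "{0..<a + 1} = insert a {0..<a}" by auto
  then show ?thesis using True by (simp add: hpow_def)
next
  case False
  then have "{a..<0} = insert a {a + 1..<0}" by auto
  then show ?thesis using False by (simp add: hpow_def)
qed

text \<open>The filling that spells a morphism out. One 2-simplex cuts (e, i) off the rest, another
  splits it as \<open>g^i e\<close>, and \<open>hpow\<close> breaks \<open>g^i\<close> into letters.
  The signs make the boundary the morphism minus the letters of its normal form.\<close>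

fun htpy :: "'v \<Rightarrow> ('e \<times> int) list \<Rightarrow> int \<Rightarrow> _" where
  "htpy v [] a = hpow v a"
| "htpy v ((e, i) # \<xi>) a = hpow v i - chain2 (gen v i) (edge e 0) + htpy (tail E e) \<xi> a
     - chain2 (edge e i) (mor (tail E e) \<xi> a)"

text \<open>The relation \<open>g^p e = e g\<close> as a 2-chain. Both products are the same
  morphism and cancel in the boundary, as do the two copies of e; \<open>hpow\<close> turns
  \<open>g^p\<close> into p letters. What is left is M(e), written in the letters g.\<close>

definition square :: "'e \<Rightarrow> _" where
  "square e = chain2 (gen (head E e) (int (p e))) (edge e 0) - hpow (head E e) (int (p e))
     - chain2 (edge e 0) (gen (tail E e) 1)"

text \<open>The exponent sum of g at each vertex in the normal form. Together with
  \<open>edge_weight\<close> it is the abelianised normal form.\<close>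

fun gen_weight :: "'v \<Rightarrow> ('e \<times> int) list \<Rightarrow> int \<Rightarrow> ('v \<Rightarrow>\<^sub>0 int)" where
  "gen_weight v [] a = frag_cmul a (frag_of v)"
| "gen_weight v ((e, i) # \<xi>) a = frag_cmul i (frag_of v) + gen_weight (tail E e) \<xi> a"

definition edge_weight :: "('e \<times> int) list \<Rightarrow> ('e \<Rightarrow>\<^sub>0 int)" where
  "edge_weight \<xi> = (\<Sum>(e, i)\<leftarrow>\<xi>. frag_of e)"

definition gens :: "('v \<Rightarrow>\<^sub>0 int) \<Rightarrow> _" where
  "gens = frag_extend (\<lambda>v. chain1 (gen v 1))"

definition edges :: "('e \<Rightarrow>\<^sub>0 int) \<Rightarrow> _" where
  "edges = frag_extend (\<lambda>e. chain1 (edge e 0))"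

lemma mor_Nil: "mor v [] a = gen v a"
  by (simp add: gen_def)

lemma mor_single: "head E e = v \<Longrightarrow> mor v [(e, i)] 0 = edge e i"
  by (simp add: edge_def)

lemma d_1_gen: "d 1 (chain2 (gen v a) (gen v b)) = chain1 (gen v b) - chain1 (gen v (a + b)) + chain1 (gen v a)"
  using d_1_chain2[of v v "[]" a "[]" b] by (simp add: gen_def)

lemma d_1_hpow: "d 1 (hpow v a) = chain1 (gen v a) - frag_cmul a (chain1 (gen v 1))"
proof (induction a rule: int_induct[where k = 0])
  case base
  then show ?case by (simp add: hpow_0 d_1_gen)
next
  case (step1 i)
  then show ?case by (simp add: hpow_add_1 cat_boundary_simps d_1_gen frag_cmul_distrib)
next
  case (step2 i)
  have "hpow v (i - 1) = hpow v i + chain2 (gen v (i - 1)) (gen v 1)"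
    using hpow_add_1[of v "i - 1"] by (metis diff_add_cancel)
  then show ?case
    using step2.IH by (simp add: cat_boundary_simps d_1_gen frag_cmul_diff_distrib)
qed

lemma d_1_gen_edge:
  assumes "head E e = v" "0 < p e"
  shows "d 1 (chain2 (gen v a) (edge e 0)) = chain1 (edge e 0)
     - chain1 (mor v [(e, a mod int (p e))] (a div int (p e))) + chain1 (gen v a)"
  using assms d_1_chain2[of v v "[]" a "[(e, 0)]" 0] by (simp add: gen_def edge_def)

lemma d_1_edge_mor:
  assumes "is_path F v ((e, i) # \<xi>)"
  shows "d 1 (chain2 (edge e i) (mor (tail E e) \<xi> a)) =
     chain1 (mor (tail E e) \<xi> a) - chain1 (mor v ((e, i) # \<xi>) a) + chain1 (edge e i)"
  using assms d_1_chain2[of "tail E e" v "[(e, i)]" 0 \<xi> a] odometer_zero[of E p "tail E e" \<xi>]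
  by (simp add: edge_def)

lemma d_1_htpy:
  assumes "is_path F v \<xi>"
  shows "d 1 (htpy v \<xi> a) = chain1 (mor v \<xi> a) - gens (gen_weight v \<xi> a) - edges (edge_weight \<xi>)"
  using assms
proof (induction v \<xi> a rule: htpy.induct)
  case (1 v a)
  then show ?case
    by (simp add: d_1_hpow mor_Nil gens_def edges_def edge_weight_def frag_extend_cmul)
next
  case (2 v e i \<xi> a)
  have "d 1 (htpy (tail E e) \<xi> a) =
      chain1 (mor (tail E e) \<xi> a) - gens (gen_weight (tail E e) \<xi> a) - edges (edge_weight \<xi>)"
    using 2 by simp
  then show ?case
    using 2(2) d_1_edge_mor[OF 2(2), of a] d_1_gen_edge[of e v i]
    by (simp add: cat_boundary_simps d_1_hpow gens_def edges_def edge_weight_def frag_extend_add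
        frag_extend_cmul mor_single p_pos)
qed

lemma d_1_square:
  assumes "e \<in> arcs E"
  shows "d 1 (square e) = frag_cmul (int (p e)) (chain1 (gen (head E e) 1)) - chain1 (gen (tail E e) 1)"
proof -
  have path: "is_path F (head E e) [(e, 0)]"
    using assms p_pos by (simp add: wellformed)
  show ?thesis
    using assms d_1_edge_mor[OF path, of 1] d_1_gen_edge[of e "head E e" "int (p e)"] p_pos[OF assms]
    by (simp add: square_def cat_boundary_simps d_1_hpow mor_Nil)
qed

definition squares :: "('e \<Rightarrow>\<^sub>0 int) \<Rightarrow> _" where
  "squares = frag_extend square"

lemma d_1_squares:
  assumes "u \<in> frag_space (arcs E)"
  shows "d 1 (squares u) = gens (odometer_M E p u)"
  using assms
proof (induction u rule: frag_space_induct)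
  case (one e)
  then show ?case
    by (simp add: squares_def gens_def odometer_M_def d_1_square frag_extend_diff frag_extend_cmul)
qed (simp_all add: squares_def gens_def odometer_M_def cat_boundary_simps frag_extend_diff)

section \<open>Abelianised normal forms under composition\<close>

lemma gen_weight_add: "gen_weight v \<xi> (a + b) = gen_weight v \<xi> a + frag_cmul b (frag_of (src v \<xi>))"
  by (induction v \<xi> a rule: gen_weight.induct) (simp_all add: frag_cmul_distrib)

lemma gen_weight_append: "gen_weight v (\<xi> @ \<eta>) b = gen_weight v \<xi> 0 + gen_weight (src v \<xi>) \<eta> b"
  by (induction v \<xi> b rule: gen_weight.induct) (simp_all add: add.assoc)

text \<open>At one digit write a + i = r + q p(e). The exponent a + i at the range becomes r there
  and q at the source, a loss of q (p(e) r(e) - s(e)) = q M(e). Summing over the carries gives the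
  correction, which is why M appears as the differential.\<close>

lemma gen_weight_move:
  assumes "is_path F v \<eta>"
  shows "gen_weight v (odometer_move p a \<eta>) (odometer_carry p a \<eta> + b) =
    frag_cmul a (frag_of v) + gen_weight v \<eta> b - odometer_M E p (odometer_carries p a \<eta>)"
  using assms
proof (induction \<eta> arbitrary: v a)
  case Nil
  then show ?case by (simp add: odometer_M_def frag_cmul_distrib)
next
  case (Cons f \<xi>)
  obtain e i where f: "f = (e, i)" by (cases f)
  let ?q = "(a + i) div int (p e)" and ?r = "(a + i) mod int (p e)"
  have v: "head E e = v" and path: "is_path F (tail E e) \<xi>"
    using Cons.prems by (simp_all add: f)
  have "a + i = ?r + ?q * int (p e)" by simp
  then have r: "frag_cmul ?r (frag_of v) =
      frag_cmul a (frag_of v) + frag_cmul i (frag_of v) - frag_cmul (?q * int (p e)) (frag_of v)"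
    by (metis add_diff_cancel_right' frag_cmul_distrib)
  have M: "odometer_M E p (frag_cmul ?q (frag_of e)) =
      frag_cmul (?q * int (p e)) (frag_of v) - frag_cmul ?q (frag_of (tail E e))"
    using v by (simp add: odometer_M_def frag_extend_cmul frag_cmul_diff2 mult.commute)
  have M_add: "odometer_M E p (x + y) = odometer_M E p x + odometer_M E p y" for x y
    by (simp add: odometer_M_def frag_extend_add)
  have "gen_weight v (odometer_move p a (f # \<xi>)) (odometer_carry p a (f # \<xi>) + b) =
      frag_cmul ?r (frag_of v) + (frag_cmul ?q (frag_of (tail E e)) + gen_weight (tail E e) \<xi> b
        - odometer_M E p (odometer_carries p ?q \<xi>))"
    using Cons.IH[OF path, of ?q] by (simp add: f)
  also have "\<dots> = frag_cmul a (frag_of v) + gen_weight v (f # \<xi>) b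
      - odometer_M E p (odometer_carries p a (f # \<xi>))"
    by (simp add: f M_add M r)
  finally show ?case .
qed

lemma edge_weight_simps:
  "edge_weight [] = 0"
  "edge_weight ((e, i) # \<xi>) = frag_of e + edge_weight \<xi>"
  "edge_weight (\<xi> @ \<eta>) = edge_weight \<xi> + edge_weight \<eta>"
  "edge_weight (odometer_move p a \<xi>) = edge_weight \<xi>"
proof -
  show "edge_weight (odometer_move p a \<xi>) = edge_weight \<xi>"
    by (induction p a \<xi> rule: odometer_move.induct) (simp_all add: edge_weight_def)
qed (simp_all add: edge_weight_def)

section \<open>The universal cocycle\<close>

text \<open>The defect is a \<open>2\<close>-cocycle modulo boundaries, so three vanishing terms of the cocycle identity
  force the fourth to vanish; this propagates vanishing from the generators to all pairs.\<close>

definition defect :: "'v \<Rightarrow> ('e \<times> int) list \<Rightarrow> int \<Rightarrow> ('e \<times> int) list \<Rightarrow> int \<Rightarrow> _" where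
  "defect v \<xi> a \<eta> b = chain2 (mor v \<xi> a) (mor (src v \<xi>) \<eta> b) - htpy v \<xi> a - htpy (src v \<xi>) \<eta> b
     + htpy v (\<xi> @ odometer_move p a \<eta>) (odometer_carry p a \<eta> + b) - squares (odometer_carries p a \<eta>)"

text \<open>The \<open>chain2\<close> terms bound a 3-simplex, the \<open>htpy\<close> terms cancel
  because a coboundary satisfies the cocycle identity, and the \<open>squares\<close> terms cancel
  by the crossed additivity of carries.\<close>

lemma defect_cocycle:
  assumes "is_path F v \<xi>" "is_path F (src v \<xi>) \<eta>" "is_path F (src (src v \<xi>) \<eta>) \<zeta>"
  shows "defect (src v \<xi>) \<eta> b \<zeta> c
    - defect v (\<xi> @ odometer_move p a \<eta>) (odometer_carry p a \<eta> + b) \<zeta> c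
    + defect v \<xi> a (\<eta> @ odometer_move p b \<zeta>) (odometer_carry p b \<zeta> + c)
    - defect v \<xi> a \<eta> b \<in> B 2"
proof -
  have path: "(\<xi> @ odometer_move p a \<eta>) @ odometer_move p (odometer_carry p a \<eta> + b) \<zeta> =
      \<xi> @ odometer_move p a (\<eta> @ odometer_move p b \<zeta>)"
    by (simp add: odometer_move_append odometer_move_add)
  have carry: "odometer_carry p (odometer_carry p a \<eta> + b) \<zeta> + c =
      odometer_carry p a (\<eta> @ odometer_move p b \<zeta>) + (odometer_carry p b \<zeta> + c)"
    by (simp add: odometer_carry_append odometer_carry_add)
  have "squares (odometer_carries p a (\<eta> @ odometer_move p b \<zeta>)) =
      squares (odometer_carries p a \<eta>) + squares (odometer_carries p (odometer_carry p a \<eta> + b) \<zeta>)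
        - squares (odometer_carries p b \<zeta>)"
    by (simp add: odometer_carries_append odometer_carries_add squares_def frag_extend_add)
  then show ?thesis
    using B2_cocycle[OF assms, of b c a] unfolding defect_def src_simps path carry by simp
qed

section \<open>Vanishing of the defect, from generators to all pairs\<close>

lemmas defect_3_out_of_4 = boundaries_3_out_of_4[OF defect_cocycle]

text \<open>The cocycle relation for \<open>g^a, g^b, g\<close> matches the recursion of
  \<open>hpow\<close>, so b can be raised or lowered by one.\<close>

lemma defect_gen_gen:
  assumes v: "v \<in> verts E"
  shows "defect v [] a [] b \<in> B 2"
proof -
  have d: "defect v [] a [] b = chain2 (gen v a) (gen v b) - hpow v a - hpow v b + hpow v (a + b)" for a b
    by (simp add: defect_def squares_def mor_Nil)
  have step: "defect v [] a [] (b + 1) \<in> B 2 \<longleftrightarrow> defect v [] a [] b \<in> B 2" for b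
  proof -
    have "chain2 (gen v b) (gen v 1) - chain2 (gen v (a + b)) (gen v 1)
        + chain2 (gen v a) (gen v (b + 1)) - chain2 (gen v a) (gen v b) \<in> B 2"
      using B2_cocycle[of v "[]" "[]" "[]" b 1 a] v by (simp add: gen_def)
    moreover have "chain2 (gen v b) (gen v 1) - chain2 (gen v (a + b)) (gen v 1)
        + chain2 (gen v a) (gen v (b + 1)) - chain2 (gen v a) (gen v b) =
        defect v [] a [] (b + 1) - defect v [] a [] b"
      using hpow_add_1[of v "a + b"] by (simp add: d hpow_add_1 add.assoc)
    ultimately have *: "defect v [] a [] (b + 1) - defect v [] a [] b \<in> B 2" by simp
    show ?thesis
      using boundaries_add[OF *, of "defect v [] a [] b"] boundaries_diff[OF _ *, of "defect v [] a [] (b + 1)"]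
      by auto
  qed
  show ?thesis
  proof (induction b rule: int_induct[where k = 0])
    case base
    have "chain2 (gen v a) (gen v 0) - chain2 (gen v 0) (gen v 0) \<in> B 2"
      using boundaries_minus[OF B2_cocycle[of v "[]" "[]" "[]" 0 0 a]] v by (simp add: gen_def)
    then show ?case by (simp add: d hpow_0)
  next
    case (step1 i)
    then show ?case by (simp add: step)
  next
    case (step2 i)
    then show ?case using step[of "i - 1"] by simp
  qed
qed

lemma is_path_edge [simp]: "e \<in> arcs E \<Longrightarrow> is_path F (head E e) [(e, i)] \<longleftrightarrow> 0 \<le> i \<and> i < int (p e)"
  by (auto simp: wellformed)

text \<open>Degenerate simplices need not vanish in the unnormalised complex, but one with an
  identity factor is congruent to the pair of identities at the same vertex. That pair is
  \<open>hpow v 0\<close>, against which it cancels later.\<close>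

lemma chain2_edge_unit:
  assumes "e \<in> arcs E" "0 \<le> i" "i < int (p e)"
  shows "chain2 (edge e i) (gen (tail E e) 0) - chain2 (gen (tail E e) 0) (gen (tail E e) 0) \<in> B 2"
  using boundaries_minus[OF B2_cocycle[of "head E e" "[(e, i)]" "[]" "[]" 0 0 0]] assms
  by (simp add: edge_def mor_Nil)

lemma chain2_unit_edge:
  assumes "e \<in> arcs E"
  shows "chain2 (gen (head E e) 0) (edge e 0) - chain2 (gen (head E e) 0) (gen (head E e) 0) \<in> B 2"
  using B2_cocycle[of "head E e" "[]" "[]" "[(e, 0)]" 0 0 0] assms p_pos[OF assms]
  by (simp add: edge_def mor_Nil)

text \<open>A single letter is already in normal form: its filling has only degenerate terms, which
  cancel against the two constants \<open>hpow _ 0\<close>.\<close>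

lemma htpy_edge_0:
  assumes "e \<in> arcs E"
  shows "htpy (head E e) [(e, 0)] 0 \<in> B 2"
proof -
  have "- (chain2 (gen (head E e) 0) (edge e 0) - chain2 (gen (head E e) 0) (gen (head E e) 0))
      - (chain2 (edge e 0) (gen (tail E e) 0) - chain2 (gen (tail E e) 0) (gen (tail E e) 0)) \<in> B 2"
    using assms p_pos[OF assms]
    by (intro boundaries_diff boundaries_minus chain2_unit_edge chain2_edge_unit) auto
  then show ?thesis by (simp add: mor_Nil hpow_0 algebra_simps)
qed

lemma hpow_1:
  assumes "v \<in> verts E"
  shows "hpow v 1 \<in> B 2"
proof -
  have "chain2 (gen v 0) (gen v 0) - chain2 (gen v 0) (gen v 1) \<in> B 2"
    using boundaries_minus[OF B2_cocycle[of v "[]" "[]" "[]" 0 1 0]] assms by (simp add: mor_Nil)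
  then show ?thesis using hpow_add_1[of v 0] by (simp add: hpow_0)
qed

text \<open>Prepending an edge to a normal form gives a normal form again. The recursion of
  \<open>htpy\<close> therefore cancels everything except degenerate terms.\<close>

lemma defect_edge_mor:
  assumes e: "e \<in> arcs E" "0 \<le> i" "i < int (p e)" and "is_path F (tail E e) \<eta>"
  shows "defect (head E e) [(e, i)] 0 \<eta> b \<in> B 2"
proof -
  have "squares (odometer_carries p 0 \<eta>) = 0"
    using odometer_carries_add[of p 0 0 \<eta>] odometer_zero(1)[OF assms(4)] by (simp add: squares_def)
  then have "defect (head E e) [(e, i)] 0 \<eta> b =
      chain2 (edge e i) (gen (tail E e) 0) - chain2 (gen (tail E e) 0) (gen (tail E e) 0)"
    using odometer_zero[OF assms(4)]
    by (simp add: defect_def mor_Nil mor_single hpow_0)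
  then show ?thesis using chain2_edge_unit[OF e] by simp
qed

text \<open>The cocycle relation for (e, i), \<open>g^q\<close> and the second factor. It is needed
  because moving a unit past an edge leaves an edge followed by the carry q.\<close>

lemma defect_edge_carry:
  assumes "e \<in> arcs E" "0 \<le> i" "i < int (p e)" "is_path F (tail E e) \<eta>"
    and "defect (tail E e) [] q \<eta> b \<in> B 2"
  shows "defect (head E e) [(e, i)] q \<eta> b \<in> B 2"
  using defect_3_out_of_4(2)[of "head E e" "[(e, i)]" "[]" \<eta> q b 0]
    defect_edge_mor[OF assms(1-3), of "[]" q] assms
    defect_edge_mor[OF assms(1-3) is_path_F_move[OF assms(4)], of q "odometer_carry p q \<eta> + b"]
  by (simp add: wellformed)

lemma defect_gen_edge:
  assumes e: "e \<in> arcs E"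
  shows "defect (head E e) [] a [(e, 0)] 0 \<in> B 2"
proof -
  let ?v = "head E e" and ?w = "tail E e"
  have p: "0 < p e" using p_pos[OF e] .
  have vw: "?v \<in> verts E" "?w \<in> verts E" using e by auto
  \<comment> \<open>No carry occurs in this range: \<open>g^a e\<close> is the edge (e, a), whose
    filling contains the pair (\<open>g^a\<close>, e) by construction.\<close>
  have small: "defect ?v [] a [(e, 0)] 0 \<in> B 2" if "0 \<le> a" "a < int (p e)" for a
  proof -
    have "defect ?v [] a [(e, 0)] 0 = - htpy ?v [(e, 0)] 0
        - (chain2 (edge e a) (gen ?w 0) - chain2 (gen ?w 0) (gen ?w 0))"
      using that by (simp add: defect_def mor_Nil mor_single hpow_0 squares_def)
    then show ?thesis
      using boundaries_diff[OF boundaries_minus[OF htpy_edge_0[OF e]] chain2_edge_unit[OF e that]] by simp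
  qed
  \<comment> \<open>Exactly one carry occurs, and the single \<open>square e\<close> subtracted in
    the defect was made to cancel this pair.\<close>
  have top: "defect ?v [] (int (p e)) [(e, 0)] 0 \<in> B 2"
  proof -
    have "defect ?v [] (int (p e)) [(e, 0)] 0 = - htpy ?v [(e, 0)] 0
        - (chain2 (gen ?v 0) (edge e 0) - chain2 (gen ?v 0) (gen ?v 0)) + hpow ?w 1"
      using p by (simp add: defect_def mor_Nil mor_single hpow_0 squares_def square_def)
    then show ?thesis
      using boundaries_add[OF boundaries_diff[OF boundaries_minus[OF htpy_edge_0[OF e]]
            chain2_unit_edge[OF e]] hpow_1[OF vw(2)]] by simp
  qed
  \<comment> \<open>Two cocycle relations: first \<open>g^a, g^p, e\<close>, where
    \<open>g^p e = e g\<close>, then \<open>g^a, e, g\<close>. Exponents can thus be reduced modulo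
    p(e).\<close>
  have step: "defect ?v [] (a + int (p e)) [(e, 0)] 0 \<in> B 2 \<longleftrightarrow> defect ?v [] a [(e, 0)] 0 \<in> B 2" for a
  proof -
    have mod: "0 \<le> a mod int (p e)" "a mod int (p e) < int (p e)" using p by auto
    have "defect ?v [] (a + int (p e)) [(e, 0)] 0 \<in> B 2 \<longleftrightarrow> defect ?v [] a [(e, 0)] 1 \<in> B 2"
      using defect_3_out_of_4(2,3)[of ?v "[]" "[]" "[(e, 0)]" "int (p e)" 0 a]
        top defect_gen_gen[OF vw(1), of a "int (p e)"] e p vw
      by auto
    also have "\<dots> \<longleftrightarrow> defect ?v [] a [(e, 0)] 0 \<in> B 2"
      using defect_3_out_of_4(3,4)[of ?v "[]" "[(e, 0)]" "[]" 0 1 a] e p vw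
        defect_edge_mor[of e 0 "[]" 1]
        defect_edge_carry[OF e mod _ defect_gen_gen[OF vw(2), of "a div int (p e)" 1]]
      by auto
    finally show ?thesis .
  qed
  have "defect ?v [] (a mod int (p e) + q * int (p e)) [(e, 0)] 0 \<in> B 2" for q
  proof (induction q rule: int_induct[where k = 0])
    case base
    then show ?case using small[of "a mod int (p e)"] p by simp
  next
    case (step1 i)
    then show ?case using step[of "a mod int (p e) + i * int (p e)"] by (simp add: algebra_simps)
  next
    case (step2 i)
    then show ?case using step[of "a mod int (p e) + (i - 1) * int (p e)"] by (simp add: algebra_simps)
  qed
  from this[of "a div int (p e)"] show ?thesis by simp
qed

text \<open>Since (e, i) = \<open>g^i e\<close>, the cocycle relation for \<open>g^a, g^i, e\<close>
  reduces every digit to the digit 0.\<close>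

lemma defect_gen_edge':
  assumes e: "e \<in> arcs E" "0 \<le> i" "i < int (p e)"
  shows "defect (head E e) [] a [(e, i)] 0 \<in> B 2"
  using defect_3_out_of_4(3)[of "head E e" "[]" "[]" "[(e, 0)]" i 0 a] e p_pos[OF e(1)]
    defect_gen_edge[OF e(1), of i] defect_gen_edge[OF e(1), of "a + i"]
    defect_gen_gen[of "head E e" a i]
  by auto

text \<open>The path is peeled from its range end by the relation for \<open>g^a\<close>, (e, i) and
  the rest. The exponent is arbitrary in the induction because the rest meets the carry instead of
  a.\<close>

lemma defect_gen_mor:
  assumes "is_path F v \<eta>"
  shows "defect v [] a \<eta> b \<in> B 2"
  using assms
proof (induction \<eta> arbitrary: v a)
  case Nil
  then show ?case by (simp add: defect_gen_gen)
next
  case (Cons f \<eta>)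
  obtain e i where f: "f = (e, i)" by (cases f)
  have e: "e \<in> arcs E" "0 \<le> i" "i < int (p e)" and path: "is_path F (tail E e) \<eta>"
    and v: "v = head E e"
    using Cons.prems by (auto simp: f)
  have mod: "0 \<le> (a + i) mod int (p e)" "(a + i) mod int (p e) < int (p e)"
    using p_pos[OF e(1)] by auto
  show ?case
    using defect_3_out_of_4(3)[of v "[]" "[(e, i)]" \<eta> 0 b a] e path
      defect_edge_mor[OF e path, of b] defect_gen_edge'[OF e, of a]
      defect_edge_carry[OF e(1) mod path Cons.IH[OF path]] odometer_zero[OF path]
    by (auto simp: f v)
qed

text \<open>Now the left factor is peeled edge by edge; the relation for (e, i), the rest of the
  left factor and the right factor leaves only the induction hypothesis.\<close>

lemma defect_in_B:
  assumes "is_path F v \<xi>" "is_path F (src v \<xi>) \<eta>"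
  shows "defect v \<xi> a \<eta> b \<in> B 2"
  using assms
proof (induction \<xi> arbitrary: v)
  case Nil
  then show ?case by (simp add: defect_gen_mor)
next
  case (Cons f \<xi>)
  obtain e i where f: "f = (e, i)" by (cases f)
  have e: "e \<in> arcs E" "0 \<le> i" "i < int (p e)" and path: "is_path F (tail E e) \<xi>"
    and v: "v = head E e" and path': "is_path F (src (tail E e) \<xi>) \<eta>"
    using Cons.prems by (auto simp: f)
  have "is_path F (tail E e) (\<xi> @ odometer_move p a \<eta>)"
    using path path' by (simp add: is_path_F_append is_path_F_move)
  then show ?case
    using defect_3_out_of_4(2)[of v "[(e, i)]" \<xi> \<eta> a b 0] e path path'
      defect_edge_mor[OF e path, of a] defect_edge_mor[OF e, of "\<xi> @ odometer_move p a \<eta>"]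
      Cons.IH[OF path path'] odometer_zero[OF path]
    by (auto simp: f v)
qed


section \<open>Comparison with the small complex\<close>

text \<open>The defaults 0 make these maps total; the simplices of \<open>X\<close> in the relevant
  degree all have the matched shape.\<close>

definition gen_part :: "(('v, ('v \<times> ('e \<times> int) list) \<times> ('v \<times> int)) simplex \<Rightarrow>\<^sub>0 int) \<Rightarrow> ('v \<Rightarrow>\<^sub>0 int)" where
  "gen_part = frag_extend (\<lambda>s. case s of Tuple [((v, \<xi>), (w, a))] \<Rightarrow> gen_weight v \<xi> a | _ \<Rightarrow> 0)"

definition edge_part :: "(('v, ('v \<times> ('e \<times> int) list) \<times> ('v \<times> int)) simplex \<Rightarrow>\<^sub>0 int) \<Rightarrow> ('e \<Rightarrow>\<^sub>0 int)" where
  "edge_part = frag_extend (\<lambda>s. case s of Tuple [((v, \<xi>), (w, a))] \<Rightarrow> edge_weight \<xi> | _ \<Rightarrow> 0)"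

definition square_part :: "(('v, ('v \<times> ('e \<times> int) list) \<times> ('v \<times> int)) simplex \<Rightarrow>\<^sub>0 int) \<Rightarrow> ('e \<Rightarrow>\<^sub>0 int)" where
  "square_part = frag_extend (\<lambda>s. case s of
     Tuple [((v, \<xi>), (w, a)), ((w', \<eta>), b)] \<Rightarrow> odometer_carries p a \<eta> | _ \<Rightarrow> 0)"

definition homotopy where
  "homotopy = frag_extend (\<lambda>s. case s of Tuple [((v, \<xi>), (w, a))] \<Rightarrow> htpy v \<xi> a | _ \<Rightarrow> 0)"

lemma part_simps:
  "gen_part (chain1 (mor v \<xi> a)) = gen_weight v \<xi> a"
  "edge_part (chain1 (mor v \<xi> a)) = edge_weight \<xi>"
  "homotopy (chain1 (mor v \<xi> a)) = htpy v \<xi> a"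
  "square_part (chain2 (mor v \<xi> a) (mor w \<eta> b)) = odometer_carries p a \<eta>"
  by (simp_all add: gen_part_def edge_part_def homotopy_def square_part_def mor_def)

lemmas part_defs = gen_part_def edge_part_def homotopy_def square_part_def

lemma part_linear:
  "gen_part 0 = 0" "gen_part (x + y) = gen_part x + gen_part y" "gen_part (x - y) = gen_part x - gen_part y"
  "gen_part (frag_cmul k x) = frag_cmul k (gen_part x)"
  "edge_part 0 = 0" "edge_part (x + y) = edge_part x + edge_part y" "edge_part (x - y) = edge_part x - edge_part y"
  "edge_part (frag_cmul k x) = frag_cmul k (edge_part x)"
  "homotopy 0 = 0" "homotopy (x + y) = homotopy x + homotopy y" "homotopy (x - y) = homotopy x - homotopy y"
  "square_part 0 = 0" "square_part (x + y) = square_part x + square_part y"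
  "square_part (x - y) = square_part x - square_part y"
  "odometer_M E p 0 = 0" "odometer_M E p (u + u') = odometer_M E p u + odometer_M E p u'"
  "odometer_M E p (u - u') = odometer_M E p u - odometer_M E p u'"
  "odometer_M E p (frag_cmul k u) = frag_cmul k (odometer_M E p u)"
  "gens 0 = 0" "gens (m + m') = gens m + gens m'" "gens (m - m') = gens m - gens m'"
  "edges 0 = 0" "edges (u + u') = edges u + edges u'" "edges (u - u') = edges u - edges u'"
  "squares 0 = 0" "squares (u + u') = squares u + squares u'" "squares (u - u') = squares u - squares u'"
  by (simp_all add: part_defs odometer_M_def gens_def edges_def squares_def frag_extend_linear)

section \<open>Chain map and homotopy identities\<close>

lemma C_1_induct [consumes 1, case_names zero mor diff]:
  assumes "z \<in> C 1" "P 0" "\<And>v \<xi> a. is_path F v \<xi> \<Longrightarrow> P (chain1 (mor v \<xi> a))"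
    and "\<And>a b. a \<in> C 1 \<Longrightarrow> b \<in> C 1 \<Longrightarrow> P a \<Longrightarrow> P b \<Longrightarrow> P (a - b)"
  shows "P z"
  using assms(1)
proof (induction z rule: frag_space_induct)
  case (one s)
  then show ?case by (cases rule: simplices_X_1_cases) (simp add: assms(3))
qed (use assms in auto)

lemma C_2_induct [consumes 1, case_names zero mor diff]:
  assumes "z \<in> C 2" "P 0"
    and "\<And>v \<xi> a \<eta> b. is_path F v \<xi> \<Longrightarrow> is_path F (src v \<xi>) \<eta> \<Longrightarrow>
           P (chain2 (mor v \<xi> a) (mor (src v \<xi>) \<eta> b))"
    and "\<And>a b. a \<in> C 2 \<Longrightarrow> b \<in> C 2 \<Longrightarrow> P a \<Longrightarrow> P b \<Longrightarrow> P (a - b)"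
  shows "P z"
  using assms(1)
proof (induction z rule: frag_space_induct)
  case (one s)
  then show ?case by (cases rule: simplices_X_2_cases) (simp add: assms(3))
qed (use assms in auto)

lemma C_3_induct [consumes 1, case_names zero mor diff]:
  assumes "z \<in> C 3" "P 0"
    and "\<And>v \<xi> a \<eta> b \<zeta> c. is_path F v \<xi> \<Longrightarrow> is_path F (src v \<xi>) \<eta> \<Longrightarrow> is_path F (src (src v \<xi>) \<eta>) \<zeta> \<Longrightarrow>
           P (frag_of (Tuple [mor v \<xi> a, mor (src v \<xi>) \<eta> b, mor (src (src v \<xi>) \<eta>) \<zeta> c]))"
    and "\<And>a b. a \<in> C 3 \<Longrightarrow> b \<in> C 3 \<Longrightarrow> P a \<Longrightarrow> P b \<Longrightarrow> P (a - b)"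
  shows "P z"
  using assms(1)
proof (induction z rule: frag_space_induct)
  case (one s)
  then show ?case by (cases rule: simplices_X_3_cases) (simp add: assms(3))
qed (use assms in auto)

lemma d_1_homotopy:
  "z \<in> C 1 \<Longrightarrow> d 1 (homotopy z) = z - gens (gen_part z) - edges (edge_part z)"
  by (induction z rule: C_1_induct) (simp_all add: part_linear part_simps cat_boundary_simps d_1_htpy)

lemma gen_part_d_1: "z \<in> C 2 \<Longrightarrow> gen_part (d 1 z) = odometer_M E p (square_part z)"
proof (induction z rule: C_2_induct)
  case (mor v \<xi> a \<eta> b)
  have "gen_weight v \<xi> a = gen_weight v \<xi> 0 + frag_cmul a (frag_of (src v \<xi>))"
    using gen_weight_add[of v \<xi> 0 a] by simp
  then show ?case
    by (simp add: d_1_chain2 part_linear part_simps gen_weight_append gen_weight_move[OF mor(2)])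
qed (simp_all add: part_linear cat_boundary_simps)

text \<open>The odometer changes digits but never the underlying edges, so the edge count is
  additive under composition.\<close>

lemma edge_part_d_1: "z \<in> C 2 \<Longrightarrow> edge_part (d 1 z) = 0"
  by (induction z rule: C_2_induct)
    (simp_all add: part_linear part_simps cat_boundary_simps d_1_chain2 edge_weight_simps)

lemma square_part_d_2: "z \<in> C 3 \<Longrightarrow> square_part (d 2 z) = 0"
  by (induction z rule: C_3_induct)
    (simp_all add: part_linear part_simps cat_boundary_simps cat_boundary_2
      odometer_carries_append odometer_carries_add)

text \<open>This is the vanishing of the defect extended linearly. It yields injectivity on second
  homology: for a cycle the homotopy term vanishes, and if no carries are counted only a boundary
  remains.\<close>

lemma homotopy_defect: "z \<in> C 2 \<Longrightarrow> z - homotopy (d 1 z) - squares (square_part z) \<in> B 2"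
proof (induction z rule: C_2_induct)
  case zero
  then show ?case by (simp add: part_linear cat_boundary_simps boundaries_0)
next
  case (mor v \<xi> a \<eta> b)
  show ?case
    using defect_in_B[OF mor, of a b]
    by (simp add: defect_def d_1_chain2 part_linear part_simps algebra_simps)
next
  case (diff x y)
  then show ?case
    using boundaries_diff[OF diff(3,4)] by (simp add: part_linear cat_boundary_simps algebra_simps)
qed

lemma d_0_d_1: "z \<in> C 2 \<Longrightarrow> d 0 (d 1 z) = 0"
  by (induction z rule: C_2_induct) (simp_all add: cat_boundary_simps d_1_chain2 cat_boundary_0)

lemma d_1_d_2: "z \<in> C 3 \<Longrightarrow> d 1 (d 2 z) = 0"
  by (induction z rule: C_3_induct)
    (simp_all add: cat_boundary_simps d_1_chain2 cat_boundary_2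
      odometer_move_append odometer_carry_append odometer_move_add odometer_carry_add add.assoc)

definition vertices :: "('v \<Rightarrow>\<^sub>0 int) \<Rightarrow> (('v, ('v \<times> ('e \<times> int) list) \<times> ('v \<times> int)) simplex \<Rightarrow>\<^sub>0 int)" where
  "vertices = frag_extend (\<lambda>v. frag_of (Vertex v))"

lemma vertices_linear: "vertices 0 = 0" "vertices (x + y) = vertices x + vertices y"
  "vertices (x - y) = vertices x - vertices y" "vertices (- x) = - vertices x"
  by (simp_all add: vertices_def frag_extend_linear)

text \<open>Sources and ranges telescope along a path. The sign arises because \<open>d 0\<close> is
  source minus range, while M with weight 1 is range minus source.\<close>

lemma d_0_eq: "z \<in> C 1 \<Longrightarrow> d 0 z = - vertices (odometer_M E (\<lambda>_. 1) (edge_part z))"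
proof (induction z rule: C_1_induct)
  case (mor v \<xi> a)
  have "vertices (odometer_M E (\<lambda>_. 1) (edge_weight \<xi>)) = frag_of (Vertex v) - frag_of (Vertex (src v \<xi>))"
    using mor
  proof (induction \<xi> arbitrary: v)
    case (Cons f \<xi>)
    then show ?case
      by (cases f) (auto simp: edge_weight_simps odometer_M_def frag_extend_linear vertices_linear vertices_def)
  qed (simp add: edge_weight_simps odometer_M_def vertices_linear)
  then show ?case by (simp add: cat_boundary_0 part_simps)
qed (simp_all add: cat_boundary_simps part_linear vertices_linear odometer_M_def frag_extend_linear)

section \<open>Supports of the constructed chains\<close>

lemma gen_in_X [simp]: "gen v a \<in> cat_mor X \<longleftrightarrow> v \<in> verts E"
  and edge_in_X: "e \<in> arcs E \<Longrightarrow> 0 \<le> i \<Longrightarrow> i < int (p e) \<Longrightarrow> edge e i \<in> cat_mor X"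
  and cod_gen [simp]: "cat_cod X (gen v a) = v" and dom_gen [simp]: "cat_dom X (gen v a) = v"
  and cod_edge [simp]: "cat_cod X (edge e i) = head E e"
  and dom_edge [simp]: "cat_dom X (edge e i) = tail E e"
  by (simp_all add: gen_def edge_def)

lemma hpow_in_C: "v \<in> verts E \<Longrightarrow> hpow v a \<in> C 2"
  unfolding hpow_def by (intro frag_space_intros sum_in_frag_space) simp_all

lemma htpy_in_C: "is_path F v \<xi> \<Longrightarrow> htpy v \<xi> a \<in> C 2"
proof (induction v \<xi> a rule: htpy.induct)
  case (2 v e i \<xi> a)
  then show ?case
    by (auto simp: wellformed edge_in_X p_pos intro!: frag_space_intros hpow_in_C)
qed (simp add: hpow_in_C)

lemma homotopy_in_C: "z \<in> C 1 \<Longrightarrow> homotopy z \<in> C 2"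
  by (induction z rule: C_1_induct) (auto simp: part_linear part_simps htpy_in_C)

lemma squares_in_C: "u \<in> frag_space (arcs E) \<Longrightarrow> squares u \<in> C 2"
  unfolding squares_def square_def
  by (rule frag_extend_in_frag_space)
    (auto simp: wellformed edge_in_X p_pos intro!: frag_space_intros hpow_in_C)

lemma gens_in_C: "m \<in> frag_space (verts E) \<Longrightarrow> gens m \<in> C 1"
  unfolding gens_def by (rule frag_extend_in_frag_space) auto

lemma edges_in_C: "u \<in> frag_space (arcs E) \<Longrightarrow> edges u \<in> C 1"
  unfolding edges_def by (rule frag_extend_in_frag_space) (auto simp: edge_in_X p_pos)

lemma edge_weight_in_frag_space: "is_path F v \<xi> \<Longrightarrow> edge_weight \<xi> \<in> frag_space (arcs E)"
proof (induction \<xi> arbitrary: v)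
  case (Cons f \<xi>)
  then show ?case by (cases f) (auto simp: edge_weight_simps)
qed (simp add: edge_weight_simps)

lemma gen_weight_in_frag_space: "is_path F v \<xi> \<Longrightarrow> gen_weight v \<xi> a \<in> frag_space (verts E)"
  by (induction v \<xi> a rule: gen_weight.induct) (auto simp: wellformed intro!: frag_space_intros)

lemma odometer_carries_in_frag_space:
  "is_path F v \<xi> \<Longrightarrow> odometer_carries p a \<xi> \<in> frag_space (arcs E)"
proof (induction \<xi> arbitrary: v a)
  case (Cons f \<xi>)
  then show ?case by (cases f) (auto intro!: frag_space_intros)
qed simp

lemma gen_part_in: "z \<in> C 1 \<Longrightarrow> gen_part z \<in> frag_space (verts E)"
  by (induction z rule: C_1_induct) (auto simp: part_linear part_simps gen_weight_in_frag_space)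

lemma edge_part_in: "z \<in> C 1 \<Longrightarrow> edge_part z \<in> frag_space (arcs E)"
  by (induction z rule: C_1_induct) (auto simp: part_linear part_simps intro: edge_weight_in_frag_space)

lemma square_part_in: "z \<in> C 2 \<Longrightarrow> square_part z \<in> frag_space (arcs E)"
  by (induction z rule: C_2_induct) (auto simp: part_linear part_simps intro: odometer_carries_in_frag_space)

section \<open>Sections of the comparison map\<close>

lemma part_gens: "gen_part (gens m) = m" "edge_part (gens m) = 0"
proof -
  show "gen_part (gens m) = m"
    by (rule frag_induction[of m UNIV])
      (simp_all add: part_linear, simp add: gens_def gen_def part_simps)
  show "edge_part (gens m) = 0"
    by (rule frag_induction[of m UNIV])
      (simp_all add: part_linear, simp add: gens_def gen_def part_simps edge_weight_simps)
qed

lemma part_edges: "gen_part (edges u) = 0" "edge_part (edges u) = u"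
proof -
  show "gen_part (edges u) = 0"
    by (rule frag_induction[of u UNIV])
      (simp_all add: part_linear, simp add: edges_def edge_def part_simps)
  show "edge_part (edges u) = u"
    by (rule frag_induction[of u UNIV])
      (simp_all add: part_linear, simp add: edges_def edge_def part_simps edge_weight_simps)
qed

lemma square_part_hpow: "square_part (hpow v a) = 0"
proof -
  have "square_part (sum f I) = (\<Sum>i\<in>I. square_part (f i))" for f and I :: "int set"
    by (induction I rule: infinite_finite_induct) (simp_all add: part_linear)
  then show ?thesis
    by (simp add: hpow_def part_linear gen_def part_simps)
qed

text \<open>Only the pair (\<open>g^p\<close>, e) moves a unit past an edge, with carry p(e) div
  p(e) = 1. In all other terms the second factor has an empty path.\<close>

lemma square_part_squares:
  assumes "u \<in> frag_space (arcs E)"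
  shows "square_part (squares u) = u"
  using assms
proof (induction u rule: frag_space_induct)
  case (one e)
  then show ?case
    using p_pos[OF one]
    by (simp add: squares_def square_def part_linear square_part_hpow)
      (simp add: gen_def edge_def part_simps)
qed (simp_all add: part_linear)

end

section \<open>Homology and cokernel\<close>

lemma subgroup_free_Abelian_groupI:
  assumes "A \<subseteq> frag_space S" "0 \<in> A" "\<And>x y. x \<in> A \<Longrightarrow> y \<in> A \<Longrightarrow> x - y \<in> A"
  shows "subgroup A (free_Abelian_group S)"
proof -
  have minus: "- x \<in> A" if "x \<in> A" for x
    using assms(3)[OF assms(2) that] by simp
  have "x + y \<in> A" if "x \<in> A" "y \<in> A" for x y
    using assms(3)[OF that(1) minus[OF that(2)]] by simp
  then show ?thesis
    using assms minus unfolding frag_space_def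
    by (intro group.subgroupI) auto
qed

lemma free_Abelian_group_coset_eq:
  assumes N: "subgroup N (free_Abelian_group S)" and "x \<in> frag_space S" "y \<in> frag_space S"
  shows "N #>\<^bsub>free_Abelian_group S\<^esub> x = N #>\<^bsub>free_Abelian_group S\<^esub> y \<longleftrightarrow> x - y \<in> N"
proof
  have x: "x \<in> carrier (free_Abelian_group S)" and y: "y \<in> carrier (free_Abelian_group S)"
    using assms by (simp_all add: frag_space_def)
  have r: "N #>\<^bsub>free_Abelian_group S\<^esub> z = (\<lambda>n. n + z) ` N" for z
    by (auto simp: r_coset_def)
  show "x - y \<in> N" if "N #>\<^bsub>free_Abelian_group S\<^esub> x = N #>\<^bsub>free_Abelian_group S\<^esub> y"
  proof -
    have "x \<in> (\<lambda>n. n + y) ` N"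
      using that group.rcos_self[OF group_free_Abelian_group x N] by (simp add: r)
    then show ?thesis by auto
  qed
  show "N #>\<^bsub>free_Abelian_group S\<^esub> x = N #>\<^bsub>free_Abelian_group S\<^esub> y" if "x - y \<in> N"
  proof -
    have "x \<in> N #>\<^bsub>free_Abelian_group S\<^esub> y"
      using that by (auto simp: r intro: image_eqI[of _ _ "x - y"])
    then show ?thesis
      using group.repr_independence[OF group_free_Abelian_group _ y N] by simp
  qed
qed

text \<open>The first isomorphism theorem phrased on bare sets of cycles, so that computing a
  homology group needs only an additive surjection whose zeros are the boundaries.\<close>

lemma cat_homology_iso:
  fixes C :: "('o, 'm) category" and \<phi> :: "(('o, 'm) simplex \<Rightarrow>\<^sub>0 int) \<Rightarrow> 'h"
  assumes H: "group H"
    and Z: "cat_cycles C k = Z" "Z \<subseteq> frag_space (simplices C k)" "0 \<in> Z"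
      "\<And>x y. x \<in> Z \<Longrightarrow> y \<in> Z \<Longrightarrow> x - y \<in> Z"
    and \<phi>: "\<And>x y. x \<in> Z \<Longrightarrow> y \<in> Z \<Longrightarrow> \<phi> (x + y) = \<phi> x \<otimes>\<^bsub>H\<^esub> \<phi> y" "\<phi> ` Z = carrier H"
      "\<And>x. x \<in> Z \<Longrightarrow> \<phi> x = \<one>\<^bsub>H\<^esub> \<longleftrightarrow> x \<in> boundaries C k"
    and B: "boundaries C k \<subseteq> Z"
  shows "group (cat_homology k C)" "cat_homology k C \<cong> H"
proof -
  let ?G = "subgroup_generated (cat_chains C k) (cat_cycles C k)"
  have sub: "subgroup Z (cat_chains C k)"
    using Z unfolding cat_chains_def by (intro subgroup_free_Abelian_groupI)
  then have carrier: "carrier ?G = Z"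
    using subgroup.carrier_subgroup_generated_subgroup Z(1) by blast
  have G: "group ?G"
    by (simp add: cat_chains_def group.group_subgroup_generated)
  have hom: "\<phi> \<in> hom ?G H"
    by (rule homI) (use \<phi> in \<open>auto simp: carrier\<close>, simp add: cat_chains_def)
  have ker: "kernel ?G H \<phi> = boundaries C k"
    using \<phi>(3) B by (auto simp: kernel_def carrier)
  have hl: "cat_homology k C = ?G Mod boundaries C k"
    by (simp add: cat_homology_def boundaries_def cat_chains_def carrier_free_Abelian_group)
  interpret group_hom ?G H \<phi>
    using G H hom by (simp add: group_hom_def group_hom_axioms_def)
  show "group (cat_homology k C)"
    using normal.factorgroup_is_group[OF normal_kernel] by (simp add: hl ker)
  show "cat_homology k C \<cong> H"
    unfolding hl by (rule Mod_kernel_iso[OF G H hom]) (simp_all add: carrier \<phi>(2) ker)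
qed

text \<open>The sum of the coefficients, obtained by sending every basis element to a single one;
  linearity is then inherited from \<open>frag_extend\<close>.\<close>

definition augmentation :: "('a \<Rightarrow>\<^sub>0 int) \<Rightarrow> int" where
  "augmentation x = Poly_Mapping.lookup (frag_extend (\<lambda>_. frag_of ()) x) ()"

lemma augmentation_simps [simp]:
  "augmentation 0 = 0" "augmentation (frag_of a) = 1"
  "augmentation (x + y) = augmentation x + augmentation y"
  "augmentation (x - y) = augmentation x - augmentation y"
  "augmentation (- x) = - augmentation x"
  "augmentation (frag_cmul n x) = n * augmentation x"
  by (simp_all add: augmentation_def frag_extend_linear lookup_add lookup_minus)

context wf_digraph
begin

text \<open>The weight is a parameter because two cases are used: the given weight for the cokernel,
  and the constant 1 for the boundary map of the graph.\<close>

definition image_M :: "('b \<Rightarrow> nat) \<Rightarrow> ('a \<Rightarrow>\<^sub>0 int) set" where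
  "image_M q = odometer_M G q ` frag_space (arcs G)"

lemma odometer_M_linear:
  "odometer_M G q 0 = 0" "odometer_M G q (u + u') = odometer_M G q u + odometer_M G q u'"
  "odometer_M G q (u - u') = odometer_M G q u - odometer_M G q u'"
  "odometer_M G q (- u) = - odometer_M G q u"
  "odometer_M G q (frag_cmul k u) = frag_cmul k (odometer_M G q u)"
  by (simp_all add: odometer_M_def frag_extend_linear)

lemma odometer_M_in: "u \<in> frag_space (arcs G) \<Longrightarrow> odometer_M G q u \<in> frag_space (verts G)"
  unfolding odometer_M_def by (rule frag_extend_in_frag_space) (auto intro!: frag_space_intros)

lemma image_M_closed:
  shows image_M_0: "0 \<in> image_M q"
    and image_M_diff: "x \<in> image_M q \<Longrightarrow> y \<in> image_M q \<Longrightarrow> x - y \<in> image_M q"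
    and image_M_add: "x \<in> image_M q \<Longrightarrow> y \<in> image_M q \<Longrightarrow> x + y \<in> image_M q"
    and image_M_cmul: "x \<in> image_M q \<Longrightarrow> frag_cmul k x \<in> image_M q"
  unfolding image_M_def
  by (auto simp flip: odometer_M_linear intro!: image_eqI[OF refl] frag_space_intros)
    (auto simp: odometer_M_linear intro: image_eqI[where x = 0])

lemma subgroup_image_M: "subgroup (image_M q) (free_Abelian_group (verts G))"
  by (rule subgroup_free_Abelian_groupI)
    (auto simp: image_M_0 image_M_diff, auto simp: image_M_def odometer_M_in)

lemma subgroup_kernel_M: "subgroup {u \<in> frag_space (arcs G). odometer_M G q u = 0} (free_Abelian_group (arcs G))"
  by (rule subgroup_free_Abelian_groupI) (auto simp: odometer_M_linear)

text \<open>Modulo the image, M(e) says s(e) \<equiv> p(e) r(e). Along a path these factors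
  multiply.\<close>

lemma path_image_M:
  "is_path G v es \<Longrightarrow>
     frag_of (path_source G (v, es)) - frag_cmul (int (prod_list (map q es))) (frag_of v) \<in> image_M q"
proof (induction es arbitrary: v)
  case Nil
  then show ?case by (simp add: image_M_0)
next
  case (Cons e es)
  let ?n = "int (prod_list (map q es))"
  have e: "e \<in> arcs G" "head G e = v" using Cons.prems by auto
  have "odometer_M G q (frag_of e) \<in> image_M q"
    using e by (simp add: image_M_def)
  then have "frag_of (path_source G (tail G e, es)) - frag_cmul ?n (frag_of (tail G e)) -
      frag_cmul ?n (odometer_M G q (frag_of e)) \<in> image_M q"
    using Cons by (intro image_M_diff[OF Cons.IH image_M_cmul]) auto
  then show ?case
    using e by (simp add: odometer_M_def frag_cmul_diff2 path_source_Cons mult.commute)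
qed

end

lemma (in odometer) odometer_homology_eq: "odometer_homology k E p = cat_homology k X"
  by (simp add: odometer_homology_def zs_homology_def X_def)

lemma (in odometer) cycles_1: "cat_cycles X 1 = {z \<in> C 1. d 0 z = 0}"
  unfolding cat_cycles_def One_nat_def by (auto simp: kernel_def cat_chains_def frag_space_def)

lemma (in odometer) cycles_2: "cat_cycles X 2 = {z \<in> C 2. d 1 z = 0}"
  unfolding cat_cycles_def numeral_2_eq_2 One_nat_def by (auto simp: kernel_def cat_chains_def frag_space_def)

locale strongly_connected_odometer = odometer E p + fin_digraph E
  for E :: "('v, 'e) pre_digraph" and p +
  assumes arcs_nonempty: "arcs E \<noteq> {}"
    and strongly_connected: "v \<in> verts E \<Longrightarrow> w \<in> verts E \<Longrightarrow>
           \<exists>\<mu> \<in> paths E. path_range \<mu> = v \<and> path_source E \<mu> = w"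
begin

abbreviation "M1 \<equiv> odometer_M E (\<lambda>_. 1)"
abbreviation "M \<equiv> odometer_M E p"
abbreviation "N \<equiv> image_M p"

lemma obtain_path:
  assumes "v \<in> verts E" "w \<in> verts E"
  obtains es where "is_path E v es" "path_source E (v, es) = w"
  using strongly_connected[OF assms] by (auto simp: paths_def path_range_def)

text \<open>By strong connectivity each vertex is the source of a path with range v, hence a
  multiple of v modulo the image. This makes the cokernel cyclic for any weight.\<close>

lemma multiple_of_vertex_mod_image:
  assumes "v \<in> verts E" "x \<in> frag_space (verts E)"
  shows "\<exists>n. x - frag_cmul n (frag_of v) \<in> image_M q"
  using assms(2)
proof (induction x rule: frag_space_induct)
  case zero
  show ?case by (rule exI[of _ 0]) (simp add: image_M_0)
next
  case (one w)
  then show ?case using obtain_path[OF assms(1) one] path_image_M by metis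
next
  case (diff x y)
  then obtain m n where "x - frag_cmul m (frag_of v) \<in> image_M q" "y - frag_cmul n (frag_of v) \<in> image_M q"
    by blast
  from image_M_diff[OF this] show ?case
    by (intro exI[of _ "m - n"]) (simp add: frag_cmul_diff_distrib algebra_simps)
qed

lemma augmentation_M1: "augmentation (M1 u) = 0"
  by (rule frag_induction[of u UNIV]) (simp_all add: odometer_M_linear, simp add: odometer_M_def)

text \<open>For the nontrivial inclusion, x is congruent to some n v; both x and the image have
  augmentation 0, so n = 0.\<close>

lemma image_M1: "image_M (\<lambda>_. 1) = {x \<in> frag_space (verts E). augmentation x = 0}"
proof
  show "image_M (\<lambda>_. 1) \<subseteq> {x \<in> frag_space (verts E). augmentation x = 0}"
    using augmentation_M1 odometer_M_in by (auto simp: image_M_def)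
  show "{x \<in> frag_space (verts E). augmentation x = 0} \<subseteq> image_M (\<lambda>_. 1)"
  proof
    fix x assume x: "x \<in> {x \<in> frag_space (verts E). augmentation x = 0}"
    obtain v where "v \<in> verts E" using arcs_nonempty wellformed by blast
    then obtain n where n: "x - frag_cmul n (frag_of v) \<in> image_M (\<lambda>_. 1)"
      using multiple_of_vertex_mod_image x by blast
    then have "augmentation (x - frag_cmul n (frag_of v)) = 0"
      unfolding image_M_def using augmentation_M1 by (metis imageE)
    then show "x \<in> image_M (\<lambda>_. 1)" using n x by simp
  qed
qed

text \<open>One vertex v is dropped. The other coordinates are independent because t - v lies in the
  image, and the coordinate at v follows from augmentation 0. The rank is |E^1| - (|E^0| -
  1).\<close>

lemma free_of_rank_kernel_M1:
  "\<exists>n. int n = 1 - euler_char E \<and> free_of_rank {u \<in> frag_space (arcs E). M1 u = 0} n"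
proof -
  obtain v where v: "v \<in> verts E" using arcs_nonempty wellformed by blast
  define T where "T = verts E - {v}"
  have "\<exists>k. k + card T = card (arcs E) \<and>
      free_of_rank {u \<in> frag_space (arcs E). \<forall>t \<in> T. Poly_Mapping.lookup (M1 u) t = 0} k"
    unfolding odometer_M_def
  proof (rule free_of_rank_kernel_coordinates, fold odometer_M_def)
    fix t assume t: "t \<in> T"
    have "frag_of t - frag_of v \<in> image_M (\<lambda>_. 1)"
      using t v by (auto simp: image_M1 T_def intro!: frag_space_intros)
    then obtain x where "x \<in> frag_space (arcs E)" "M1 x = frag_of t - frag_of v"
      by (auto simp: image_M_def)
    then show "\<exists>x\<in>frag_space (arcs E). Poly_Mapping.lookup (M1 x) t \<noteq> 0 \<and>
        (\<forall>u\<in>T - {t}. Poly_Mapping.lookup (M1 x) u = 0)"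
      using t by (intro bexI[of _ x]) (auto simp: lookup_minus T_def)
  qed (auto simp: T_def)
  then obtain k where k: "k + card T = card (arcs E)"
    "free_of_rank {u \<in> frag_space (arcs E). \<forall>t \<in> T. Poly_Mapping.lookup (M1 u) t = 0} k"
    by blast
  have "M1 u = 0" if u: "u \<in> frag_space (arcs E)" "\<forall>t \<in> T. Poly_Mapping.lookup (M1 u) t = 0" for u
  proof -
    let ?c = "Poly_Mapping.lookup (M1 u) v"
    have "M1 u = frag_cmul ?c (frag_of v)"
    proof (rule poly_mapping_eqI)
      fix t
      have "Poly_Mapping.lookup (M1 u) t = 0" if "t \<notin> verts E"
        using odometer_M_in[OF u(1), of "\<lambda>_. 1"] that by (auto simp: frag_space_def in_keys_iff)
      then show "Poly_Mapping.lookup (M1 u) t = Poly_Mapping.lookup (frag_cmul ?c (frag_of v)) t"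
        using u(2) by (cases "t \<in> verts E") (auto simp: T_def)
    qed
    moreover from this have "?c = 0"
      using augmentation_M1[of u] by (metis augmentation_simps(2,6) mult.right_neutral)
    ultimately show ?thesis by simp
  qed
  then have "{u \<in> frag_space (arcs E). \<forall>t \<in> T. Poly_Mapping.lookup (M1 u) t = 0}
      = {u \<in> frag_space (arcs E). M1 u = 0}"
    by auto
  moreover have "card (verts E) = Suc (card T)"
    using card_Suc_Diff1[OF _ v] by (simp add: T_def)
  ultimately show ?thesis
    using k by (intro exI[of _ k]) (simp add: euler_char_def)
qed

section \<open>The homology groups in degrees 0, 2 and 1\<close>

lemma homology_0: "odometer_homology 0 E p \<cong> integer_group"
  unfolding odometer_homology_eq
proof (rule cat_homology_iso(2)[where \<phi> = augmentation])
  have C0: "C 0 = vertices ` frag_space (verts E)"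
  proof
    have "z \<in> vertices ` frag_space (verts E)" if "z \<in> C 0" for z
      using that
    proof (induction z rule: frag_space_induct)
      case zero
      then show ?case by (intro image_eqI[where x = 0]) (simp_all add: vertices_linear)
    next
      case (one s)
      then obtain v where "s = Vertex v" "v \<in> verts E" by (auto simp: simplices_def)
      then show ?case by (intro image_eqI[where x = "frag_of v"]) (simp_all add: vertices_def)
    next
      case (diff a b)
      then show ?case by (auto simp flip: vertices_linear intro!: imageI frag_space_intros)
    qed
    then show "C 0 \<subseteq> vertices ` frag_space (verts E)" by blast
    show "vertices ` frag_space (verts E) \<subseteq> C 0"
      by (auto simp: vertices_def simplices_def intro!: frag_extend_in_frag_space)
  qed
  have aug: "augmentation (vertices x) = augmentation x" for x
    by (rule frag_induction[of x UNIV]) (simp_all add: vertices_linear, simp add: vertices_def)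
  have B0: "boundaries X 0 = vertices ` image_M (\<lambda>_. 1)"
  proof
    show "boundaries X 0 \<subseteq> vertices ` image_M (\<lambda>_. 1)"
    proof
      fix y assume "y \<in> boundaries X 0"
      then obtain z where z: "z \<in> C 1" "y = d 0 z" by (auto simp: boundaries_def One_nat_def)
      have "- edge_part z \<in> frag_space (arcs E)" using edge_part_in[OF z(1)] by auto
      then show "y \<in> vertices ` image_M (\<lambda>_. 1)"
        using z by (auto simp: d_0_eq image_M_def odometer_M_linear vertices_linear
            intro!: image_eqI[where x = "M1 (- edge_part z)"])
    qed
    show "vertices ` image_M (\<lambda>_. 1) \<subseteq> boundaries X 0"
    proof
      fix y assume "y \<in> vertices ` image_M (\<lambda>_. 1)"
      then obtain u where u: "u \<in> frag_space (arcs E)" "y = vertices (M1 u)"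
        by (auto simp: image_M_def)
      then have "edges (- u) \<in> C 1" by (auto intro: edges_in_C)
      moreover have "y = d 0 (edges (- u))"
        using u \<open>edges (- u) \<in> C 1\<close>
        by (simp add: d_0_eq part_edges odometer_M_linear vertices_linear)
      ultimately show "y \<in> boundaries X 0" using boundariesI[of _ X 0] by (simp add: One_nat_def)
    qed
  qed
  show "cat_cycles X 0 = C 0"
    by (simp add: cat_cycles_def cat_chains_def carrier_free_Abelian_group)
  show "augmentation ` C 0 = carrier integer_group"
  proof -
    obtain v where v: "v \<in> verts E" using arcs_nonempty wellformed by blast
    have "n \<in> augmentation ` C 0" for n
      using v by (intro image_eqI[of _ _ "vertices (frag_cmul n (frag_of v))"]) (auto simp: aug C0 intro!: imageI)
    then show ?thesis by auto
  qed
  show "augmentation x = \<one>\<^bsub>integer_group\<^esub> \<longleftrightarrow> x \<in> boundaries X 0" if "x \<in> C 0" for x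
    using that by (auto simp: B0 C0 aug image_M1)
  show "boundaries X 0 \<subseteq> C 0"
    by (auto simp: B0 C0 image_M1)
qed auto

definition kernel_group :: "('e \<Rightarrow> nat) \<Rightarrow> ('e \<Rightarrow>\<^sub>0 int) monoid" where
  "kernel_group q = subgroup_generated (free_Abelian_group (arcs E))
     {u \<in> frag_space (arcs E). odometer_M E q u = 0}"

lemma carrier_kernel_group: "carrier (kernel_group q) = {u \<in> frag_space (arcs E). odometer_M E q u = 0}"
  unfolding kernel_group_def by (rule subgroup.carrier_subgroup_generated_subgroup[OF subgroup_kernel_M])

lemma kernel_group_simps [simp]:
  "group (kernel_group q)" "u \<otimes>\<^bsub>kernel_group q\<^esub> u' = u + u'" "\<one>\<^bsub>kernel_group q\<^esub> = 0"
  by (simp_all add: kernel_group_def group.group_subgroup_generated)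

text \<open>For u in ker M the chain \<open>squares u\<close> is a cycle with carry count u, which
  gives surjectivity; \<open>homotopy_defect\<close> gives injectivity.\<close>

lemma homology_2: "odometer_homology 2 E p \<cong> kernel_group p"
  unfolding odometer_homology_eq
proof (rule cat_homology_iso(2)[where \<phi> = square_part])
  show "cat_cycles X 2 = {z \<in> C 2. d 1 z = 0}"
    by (rule cycles_2)
  show "square_part ` {z \<in> C 2. d 1 z = 0} = carrier (kernel_group p)"
  proof
    show "square_part ` {z \<in> C 2. d 1 z = 0} \<subseteq> carrier (kernel_group p)"
    proof
      fix u assume "u \<in> square_part ` {z \<in> C 2. d 1 z = 0}"
      then obtain z where "z \<in> C 2" "d 1 z = 0" "u = square_part z" by blast
      then show "u \<in> carrier (kernel_group p)"
        using gen_part_d_1[of z] square_part_in[of z] by (simp add: carrier_kernel_group part_linear)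
    qed
    show "carrier (kernel_group p) \<subseteq> square_part ` {z \<in> C 2. d 1 z = 0}"
    proof
      fix u assume "u \<in> carrier (kernel_group p)"
      then have u: "u \<in> frag_space (arcs E)" "M u = 0" by (auto simp: carrier_kernel_group)
      then show "u \<in> square_part ` {z \<in> C 2. d 1 z = 0}"
        using squares_in_C d_1_squares[OF u(1)] square_part_squares[OF u(1)]
        by (intro image_eqI[of _ _ "squares u"]) (simp_all add: part_linear)
    qed
  qed
  have B2: "boundaries X 2 = d 2 ` C 3"
    by (simp add: boundaries_def flip: eval_nat_numeral(3))
  show "square_part z = \<one>\<^bsub>kernel_group p\<^esub> \<longleftrightarrow> z \<in> boundaries X 2"
    if "z \<in> {z \<in> C 2. d 1 z = 0}" for z
    using homotopy_defect[of z] square_part_d_2 that by (auto simp: part_linear B2)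
  have "d 2 z \<in> C 2" if "z \<in> C 3" for z
    using that
  proof (induction z rule: C_3_induct)
    case (mor v \<xi> a \<eta> b \<zeta> c)
    then show ?case
      by (auto simp: cat_boundary_2 is_path_F_append is_path_F_move intro!: frag_space_intros)
  qed (auto simp: cat_boundary_simps)
  then show "boundaries X 2 \<subseteq> {z \<in> C 2. d 1 z = 0}"
    by (auto simp: B2 d_1_d_2)
qed (auto simp: part_linear cat_boundary_simps)

definition coset :: "('v \<Rightarrow>\<^sub>0 int) \<Rightarrow> ('v \<Rightarrow>\<^sub>0 int) set" where
  "coset x = N #>\<^bsub>free_Abelian_group (verts E)\<^esub> x"

lemma coker_eq: "odometer_coker E p = free_Abelian_group (verts E) Mod N"
  by (simp add: odometer_coker_def image_M_def carrier_free_Abelian_group)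

lemma normal_N: "N \<lhd> free_Abelian_group (verts E)"
  using comm_group.subgroup_imp_normal[OF abelian_free_Abelian_group subgroup_image_M] .

lemma group_coker: "group (odometer_coker E p)"
  unfolding coker_eq by (rule normal.factorgroup_is_group[OF normal_N])

lemma carrier_coker: "carrier (odometer_coker E p) = coset ` frag_space (verts E)"
  by (simp add: coker_eq carrier_FactGroup coset_def carrier_free_Abelian_group)

lemma coset_eq_iff:
  "x \<in> frag_space (verts E) \<Longrightarrow> y \<in> frag_space (verts E) \<Longrightarrow> coset x = coset y \<longleftrightarrow> x - y \<in> N"
  unfolding coset_def by (rule free_Abelian_group_coset_eq[OF subgroup_image_M])

lemma coset_add:
  assumes "x \<in> frag_space (verts E)" "y \<in> frag_space (verts E)"
  shows "coset (x + y) = coset x \<otimes>\<^bsub>odometer_coker E p\<^esub> coset y"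
  using hom_mult[OF normal.r_coset_hom_Mod[OF normal_N], of x y] assms
  by (simp add: coset_def coker_eq frag_space_def)

lemma coset_eq_one_iff:
  assumes "x \<in> frag_space (verts E)"
  shows "coset x = \<one>\<^bsub>odometer_coker E p\<^esub> \<longleftrightarrow> x \<in> N"
proof -
  have "coset 0 = \<one>\<^bsub>odometer_coker E p\<^esub>"
    using group.coset_join2[OF group_free_Abelian_group _ subgroup_image_M image_M_0]
    by (simp add: coset_def coker_eq)
  then show ?thesis using coset_eq_iff[OF assms, of 0] by simp
qed

text \<open>The letters g are cycles and matter modulo the relations M, while edge chains must
  satisfy the graph's own cycle condition and are never boundaries. The two parts do not interact,
  so the product is direct.\<close>

lemma homology_1:
  "group (odometer_homology 1 E p)"
  "odometer_homology 1 E p \<cong> odometer_coker E p \<times>\<times> kernel_group (\<lambda>_. 1)"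
proof -
  let ?Z = "{z \<in> C 1. d 0 z = 0}" and ?H = "odometer_coker E p \<times>\<times> kernel_group (\<lambda>_. 1)"
  let ?f = "\<lambda>z. (coset (gen_part z), edge_part z)"
  have vertices_inj: "x = 0" if "vertices x = 0" for x
  proof -
    have "frag_extend (\<lambda>s. case s of Vertex v \<Rightarrow> frag_of v | _ \<Rightarrow> 0) (vertices x) = x"
      unfolding vertices_def frag_extend_frag_extend by (simp add: comp_def flip: frag_expansion)
    then show ?thesis using that by simp
  qed
  have B1: "boundaries X 1 = d 1 ` C 2"
    by (simp add: boundaries_def flip: numeral_2_eq_2)
  have H: "group ?H"
    by (rule DirProd_group) (simp_all add: group_coker)
  have add: "?f (x + y) = ?f x \<otimes>\<^bsub>?H\<^esub> ?f y" if "x \<in> ?Z" "y \<in> ?Z" for x y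
    using that by (simp add: part_linear coset_add gen_part_in)
  have onto: "?f ` ?Z = carrier ?H"
  proof
    show "?f ` ?Z \<subseteq> carrier ?H"
      using vertices_inj
      by (auto simp: carrier_coker carrier_kernel_group gen_part_in edge_part_in d_0_eq)
    show "carrier ?H \<subseteq> ?f ` ?Z"
    proof
      fix y assume "y \<in> carrier ?H"
      then obtain m u where y: "y = (coset m, u)" and m: "m \<in> frag_space (verts E)"
        and u: "u \<in> frag_space (arcs E)" "M1 u = 0"
        by (auto simp: carrier_coker carrier_kernel_group)
      have "gens m + edges u \<in> C 1" using gens_in_C[OF m] edges_in_C[OF u(1)] by auto
      then have Z: "gens m + edges u \<in> ?Z" and f: "?f (gens m + edges u) = y"
        using u y by (simp_all add: d_0_eq part_linear part_gens part_edges vertices_linear)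
      show "y \<in> ?f ` ?Z" by (rule image_eqI[where f = ?f, OF f[symmetric] Z])
    qed
  qed
  have ker: "?f z = \<one>\<^bsub>?H\<^esub> \<longleftrightarrow> z \<in> boundaries X 1" if z: "z \<in> ?Z" for z
  proof
    assume "?f z = \<one>\<^bsub>?H\<^esub>"
    then have "gen_part z \<in> N" and e: "edge_part z = 0"
      using z by (auto simp: coset_eq_one_iff gen_part_in)
    then obtain u where u: "u \<in> frag_space (arcs E)" "gen_part z = M u"
      by (auto simp: image_M_def)
    \<comment> \<open>The homotopy leaves only the letters of z. Its edge part is zero and its
      g-part is M(u), which \<open>squares u\<close> bounds.\<close>
    have "z = d 1 (homotopy z + squares u)"
      using z u e d_1_squares[OF u(1)] d_1_homotopy[of z] by (simp add: cat_boundary_simps part_linear)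
    moreover have "homotopy z + squares u \<in> C 2"
      using z u by (auto intro!: frag_space_intros homotopy_in_C squares_in_C)
    ultimately show "z \<in> boundaries X 1" by (auto simp: B1)
  next
    assume "z \<in> boundaries X 1"
    then obtain c where c: "c \<in> C 2" "z = d 1 c" by (auto simp: B1)
    then have "gen_part z \<in> N"
      using gen_part_d_1 square_part_in by (auto simp: image_M_def)
    then show "?f z = \<one>\<^bsub>?H\<^esub>"
      using z c edge_part_d_1 by (simp add: coset_eq_one_iff gen_part_in)
  qed
  have "d 1 z \<in> C 1" if "z \<in> C 2" for z
    using that
  proof (induction z rule: C_2_induct)
    case (mor v \<xi> a \<eta> b)
    then show ?case
      by (auto simp: d_1_chain2 is_path_F_append is_path_F_move intro!: frag_space_intros)
  qed (auto simp: cat_boundary_simps)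
  then have B: "boundaries X 1 \<subseteq> ?Z"
    by (auto simp: B1 d_0_d_1)
  have Z: "?Z \<subseteq> C 1" "0 \<in> ?Z" "\<And>x y. x \<in> ?Z \<Longrightarrow> y \<in> ?Z \<Longrightarrow> x - y \<in> ?Z"
    by (auto simp: cat_boundary_simps)
  show "group (odometer_homology 1 E p)" "odometer_homology 1 E p \<cong> ?H"
    unfolding odometer_homology_eq
    using cat_homology_iso[OF H cycles_1 Z add onto ker B] by blast+
qed


section \<open>Constant weight one\<close>

lemma kernel_group_iso_int_power:
  "free_of_rank {u \<in> frag_space (arcs E). odometer_M E q u = 0} n \<Longrightarrow> kernel_group q \<cong> int_power n"
  unfolding kernel_group_def by (rule free_of_rank_iso_int_power[OF subgroup_kernel_M])

text \<open>Here M is the weight 1 map, so the same kernel gives the second homology and the edge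
  summand of the first. The cokernel, infinite cyclic via the augmentation, supplies the extra
  factor in degree 1.\<close>

lemma weights_one:
  assumes "\<forall>e \<in> arcs E. p e = 1"
  obtains n where "int n = 1 - euler_char E" "odometer_homology 2 E p \<cong> int_power n"
    "odometer_homology 1 E p \<cong> int_power (Suc n)"
proof -
  obtain n where n: "int n = 1 - euler_char E" "free_of_rank {u \<in> frag_space (arcs E). M1 u = 0} n"
    using free_of_rank_kernel_M1 by blast
  note K = kernel_group_iso_int_power[OF n(2)]
  have M: "M u = M1 u" if "u \<in> frag_space (arcs E)" for u
    unfolding odometer_M_def by (rule frag_extend_eqI[OF that]) (use assms in simp)
  have "kernel_group p = kernel_group (\<lambda>_. 1)"
    unfolding kernel_group_def using M by (intro arg_cong2[where f = subgroup_generated]) auto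
  then have H2: "odometer_homology 2 E p \<cong> int_power n"
    using iso_trans[OF homology_2] K by simp
  obtain v where v: "v \<in> verts E" using arcs_nonempty wellformed by blast
  have "N = image_M (\<lambda>_. 1)"
    using M by (auto simp: image_M_def)
  then have ker: "kernel (free_Abelian_group (verts E)) integer_group augmentation = N"
    by (simp add: image_M1 kernel_def carrier_free_Abelian_group del: carrier_free_Abelian_group_iff)
  have onto: "augmentation ` carrier (free_Abelian_group (verts E)) = carrier integer_group"
  proof -
    have "n \<in> augmentation ` frag_space (verts E)" for n
      using v by (intro image_eqI[of _ _ "frag_cmul n (frag_of v)"]) auto
    then show ?thesis by (auto simp: carrier_free_Abelian_group)
  qed
  have "odometer_coker E p \<cong> integer_group"
    unfolding coker_eq by (rule Mod_kernel_iso[OF _ _ _ onto ker]) (auto simp: hom_def)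
  then have "odometer_coker E p \<times>\<times> kernel_group (\<lambda>_. 1) \<cong> integer_group \<times>\<times> int_power n"
    using K by (rule group.DirProd_iso_trans[OF group_coker])
  then have "odometer_homology 1 E p \<cong> int_power (Suc n)"
    by (rule iso_trans[OF iso_trans[OF homology_1(2)] DirProd_integer_int_power])
  from n(1) H2 this show thesis by (rule that)
qed

section \<open>A weight greater than one: finiteness and rank\<close>

lemma torsion:
  assumes "e \<in> arcs E" "p e > 1"
  obtains m :: nat where "m > 0" "\<And>x. x \<in> frag_space (verts E) \<Longrightarrow> frag_cmul (int m) x \<in> N"
proof -
  let ?v = "head E e" and ?w = "tail E e"
  obtain es where es: "is_path E ?w es" "path_source E (?w, es) = ?v"
    using obtain_path[OF tail_in_verts[OF assms(1)] head_in_verts[OF assms(1)]] by blast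
  let ?fs = "e # es"
  have path: "is_path E ?v ?fs" "path_source E (?v, ?fs) = ?v"
    using es assms by (auto simp: path_source_Cons)
  \<comment> \<open>The weight of a closed path through e; it exceeds 1 since e contributes a factor
    > 1 and the other factors are positive. Going round once gives v \<equiv> k v, so k - 1 kills v,
    and with it the whole cyclic cokernel.\<close>
  define k where "k = prod_list (map p ?fs)"
  have "is_path E u xs \<Longrightarrow> prod_list (map p xs) > 0" for u xs
    by (induction xs arbitrary: u) (auto simp: p_pos)
  then have "prod_list (map p es) > 0" using es(1) by blast
  then have "k > 1" using assms(2) by (simp add: k_def less_1_mult')
  have kv: "frag_cmul (int (k - 1)) (frag_of ?v) \<in> N"
  proof -
    have "frag_of ?v - frag_cmul (int k) (frag_of ?v) \<in> N"
      using path_image_M[OF path(1), of p] path(2) by (simp add: k_def)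
    from image_M_cmul[OF this, of "-1"] show ?thesis
      using \<open>k > 1\<close> by (simp add: of_nat_diff frag_cmul_diff_distrib)
  qed
  have "frag_cmul (int (k - 1)) x \<in> N" if x: "x \<in> frag_space (verts E)" for x
  proof -
    obtain n where "x - frag_cmul n (frag_of ?v) \<in> N"
      using multiple_of_vertex_mod_image[OF _ x, of ?v p] assms(1) by auto
    from image_M_add[OF image_M_cmul[OF this, of "int (k - 1)"] image_M_cmul[OF kv, of n]]
    show ?thesis by (simp add: frag_cmul_diff2 mult.commute)
  qed
  then show thesis using \<open>k > 1\<close> by (intro that[of "k - 1"]) auto
qed

lemma cyclic_coker: "cyclic_group (odometer_coker E p)"
proof -
  obtain v where v: "v \<in> verts E" using arcs_nonempty wellformed by blast
  have pow: "coset (frag_of v) [^]\<^bsub>odometer_coker E p\<^esub> n = coset (frag_cmul n (frag_of v))" for n :: int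
    using normal.FactGroup_int_pow[OF normal_N, of "frag_of v" n] v
    by (simp add: coset_def coker_eq)
  show ?thesis
    unfolding group.cyclic_group[OF group_coker]
  proof (rule bexI[of _ "coset (frag_of v)"])
    show "carrier (odometer_coker E p) = range (\<lambda>n::int. coset (frag_of v) [^]\<^bsub>odometer_coker E p\<^esub> n)"
    proof
      show "carrier (odometer_coker E p) \<subseteq> range (\<lambda>n::int. coset (frag_of v) [^]\<^bsub>odometer_coker E p\<^esub> n)"
      proof
        fix y assume "y \<in> carrier (odometer_coker E p)"
        then obtain x where x: "x \<in> frag_space (verts E)" "y = coset x" by (auto simp: carrier_coker)
        then obtain n where "x - frag_cmul n (frag_of v) \<in> N"
          using multiple_of_vertex_mod_image[OF v] by blast
        then have "y = coset (frag_cmul n (frag_of v))"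
          using x v coset_eq_iff[of x "frag_cmul n (frag_of v)"] by (simp add: frag_space_intros)
        then show "y \<in> range (\<lambda>n::int. coset (frag_of v) [^]\<^bsub>odometer_coker E p\<^esub> n)"
          by (simp add: pow)
      qed
      show "range (\<lambda>n::int. coset (frag_of v) [^]\<^bsub>odometer_coker E p\<^esub> n) \<subseteq> carrier (odometer_coker E p)"
        using v by (auto simp: pow carrier_coker intro!: imageI)
    qed
    show "coset (frag_of v) \<in> carrier (odometer_coker E p)"
      using v by (auto simp: carrier_coker intro!: imageI)
  qed
qed

lemma finite_coker:
  assumes "e \<in> arcs E" "p e > 1"
  shows "finite (carrier (odometer_coker E p))"
proof -
  obtain v where v: "v \<in> verts E" using arcs_nonempty wellformed by blast
  obtain m :: nat where m: "m > 0" "\<And>x. x \<in> frag_space (verts E) \<Longrightarrow> frag_cmul (int m) x \<in> N"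
    using torsion[OF assms] by blast
  \<comment> \<open>Since m annihilates the cokernel, only the residue of the multiplier of v modulo
    m matters.\<close>
  have "carrier (odometer_coker E p) \<subseteq> (\<lambda>n. coset (frag_cmul n (frag_of v))) ` {0..<int m}"
  proof
    fix y assume "y \<in> carrier (odometer_coker E p)"
    then obtain x where x: "x \<in> frag_space (verts E)" "y = coset x" by (auto simp: carrier_coker)
    then obtain n where n: "x - frag_cmul n (frag_of v) \<in> N"
      using multiple_of_vertex_mod_image[OF v] by blast
    have "frag_cmul (int m) (frag_cmul (n div int m) (frag_of v)) \<in> N"
      using v by (intro m(2)) auto
    from image_M_add[OF n this]
    have "x - (frag_cmul n (frag_of v) - frag_cmul (int m * (n div int m)) (frag_of v)) \<in> N"
      by (simp add: algebra_simps)
    then have "x - frag_cmul (n mod int m) (frag_of v) \<in> N"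
      by (simp flip: frag_cmul_diff_distrib add: minus_mult_div_eq_mod)
    then have "y = coset (frag_cmul (n mod int m) (frag_of v))"
      using x v coset_eq_iff[of x "frag_cmul (n mod int m) (frag_of v)"] by (simp add: frag_space_intros)
    then show "y \<in> (\<lambda>n. coset (frag_cmul n (frag_of v))) ` {0..<int m}"
      using m(1) by auto
  qed
  then show ?thesis by (rule finite_subset) simp
qed

text \<open>The image contains m t for every vertex t, so all |E^0| coordinates are independent and
  no vertex has to be dropped. The rank is |E^1| - |E^0|.\<close>

lemma free_of_rank_kernel_M:
  assumes "e \<in> arcs E" "p e > 1"
  shows "\<exists>n. int n = - euler_char E \<and> free_of_rank {u \<in> frag_space (arcs E). M u = 0} n"
proof -
  obtain m :: nat where m: "m > 0" "\<And>x. x \<in> frag_space (verts E) \<Longrightarrow> frag_cmul (int m) x \<in> N"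
    using torsion[OF assms] by blast
  have "\<exists>k. k + card (verts E) = card (arcs E) \<and>
      free_of_rank {u \<in> frag_space (arcs E). \<forall>t \<in> verts E. Poly_Mapping.lookup (M u) t = 0} k"
    unfolding odometer_M_def
  proof (rule free_of_rank_kernel_coordinates, fold odometer_M_def)
    fix t assume t: "t \<in> verts E"
    have "frag_cmul (int m) (frag_of t) \<in> N"
      using t m(2) by simp
    then obtain x where "x \<in> frag_space (arcs E)" "M x = frag_cmul (int m) (frag_of t)"
      by (auto simp: image_M_def)
    then show "\<exists>x\<in>frag_space (arcs E). Poly_Mapping.lookup (M x) t \<noteq> 0 \<and>
        (\<forall>u\<in>verts E - {t}. Poly_Mapping.lookup (M x) u = 0)"
      using m(1) by (intro bexI[of _ x]) auto
  qed auto
  then obtain k where k: "k + card (verts E) = card (arcs E)"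
    "free_of_rank {u \<in> frag_space (arcs E). \<forall>t \<in> verts E. Poly_Mapping.lookup (M u) t = 0} k"
    by blast
  have "M u = 0" if "u \<in> frag_space (arcs E)" "\<forall>t \<in> verts E. Poly_Mapping.lookup (M u) t = 0" for u
  proof (rule poly_mapping_eqI)
    fix t show "Poly_Mapping.lookup (M u) t = Poly_Mapping.lookup 0 t"
      using that odometer_M_in[OF that(1), of p]
      by (cases "t \<in> verts E") (auto simp: frag_space_def in_keys_iff)
  qed
  then have "{u \<in> frag_space (arcs E). \<forall>t \<in> verts E. Poly_Mapping.lookup (M u) t = 0}
      = {u \<in> frag_space (arcs E). M u = 0}"
    by auto
  then show ?thesis
    using k by (intro exI[of _ k]) (simp add: euler_char_def)
qed

lemma trivial_coker:
  assumes "e \<in> arcs E" "p e > 1"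
    and gcd: "Gcd {int (path_weight p \<mu>) - int (path_weight p \<nu>) | \<mu> \<nu>.
                    \<mu> \<in> paths E \<and> \<nu> \<in> paths E \<and>
                    path_source E \<mu> = path_source E \<nu> \<and> path_range \<mu> = path_range \<nu>} = 1"
      (is "Gcd ?D = 1")
  shows "trivial_group (odometer_coker E p)"
proof -
  have vertex: "frag_of v \<in> N" if v: "v \<in> verts E" for v
  proof -
    let ?P = "\<lambda>m :: nat. m > 0 \<and> frag_cmul (int m) (frag_of v) \<in> N"
    have "\<exists>m. ?P m"
      using torsion[OF assms(1,2)] v by (metis frag_space_simps(2))
    \<comment> \<open>The order of v in the cokernel, which is finite by torsion. It divides every n
      with n v in the image, by division with remainder.\<close>
    define m where "m = (LEAST m. ?P m)"
    have m: "?P m" unfolding m_def by (rule LeastI_ex) fact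
    have dvd: "int m dvd n" if n: "frag_cmul n (frag_of v) \<in> N" for n
    proof (rule ccontr)
      assume "\<not> int m dvd n"
      then have pos: "n mod int m > 0"
        using m by (metis dvd_eq_mod_eq_0 of_nat_0_less_iff order_le_imp_less_or_eq pos_mod_sign)
      have "frag_cmul n (frag_of v) - frag_cmul (n div int m) (frag_cmul (int m) (frag_of v)) \<in> N"
        by (rule image_M_diff[OF n image_M_cmul[OF conjunct2[OF m]]])
      then have "frag_cmul (n mod int m) (frag_of v) \<in> N"
        by (simp flip: frag_cmul_diff_distrib add: minus_div_mult_eq_mod)
      then have "?P (nat (n mod int m))" using pos by simp
      then have "m \<le> nat (n mod int m)" unfolding m_def by (rule Least_le)
      moreover have "n mod int m < int m" using m by simp
      ultimately show False using pos by linarith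
    qed
    have "int m dvd k" if k_in: "k \<in> ?D" for k
    proof -
      obtain r es fs where k: "k = int (prod_list (map p es)) - int (prod_list (map p fs))"
        and paths: "is_path E r es" "is_path E r fs" "path_source E (r, es) = path_source E (r, fs)"
        using k_in by (auto simp: paths_def path_weight_def path_range_def)
      have "r \<in> verts E" using paths(1) is_path_range wf_digraph_axioms by metis
      then obtain gs where gs: "is_path E r gs" "path_source E (r, gs) = v"
        using obtain_path v by metis
      let ?l = "int (prod_list (map p gs))"
      \<comment> \<open>Modulo the image the common source is both p(\<mu>) r and p(\<nu>) r, so
        their difference k kills r.\<close>
      have "frag_cmul k (frag_of r) =
          (frag_of (path_source E (r, fs)) - frag_cmul (int (prod_list (map p fs))) (frag_of r)) -
          (frag_of (path_source E (r, es)) - frag_cmul (int (prod_list (map p es))) (frag_of r))"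
        by (simp add: k frag_cmul_diff_distrib paths(3) del: minus_frag_cmul)
      then have "frag_cmul k (frag_of r) \<in> N"
        by (simp only:) (intro image_M_diff path_image_M paths)
      \<comment> \<open>A path with range r and source v gives v \<equiv> l r, hence k v \<equiv> l
        (k r) \<equiv> 0.\<close>
      from image_M_add[OF image_M_cmul[OF path_image_M[OF gs(1), of p], of k] image_M_cmul[OF this, of ?l]]
      have "frag_cmul k (frag_of v) \<in> N"
        using gs(2) by (simp add: frag_cmul_diff2 mult.commute)
      then show ?thesis by (rule dvd)
    qed
    then have "int m dvd Gcd ?D" by (rule Gcd_greatest)
    then have "m = 1" using gcd by simp
    then show ?thesis using m by simp
  qed
  have "x \<in> N" if "x \<in> frag_space (verts E)" for x
    using that by (induction x rule: frag_space_induct) (auto simp: image_M_0 vertex image_M_diff)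
  then have "carrier (odometer_coker E p) = {\<one>\<^bsub>odometer_coker E p\<^esub>}"
    using coset_eq_one_iff frag_space_simps(1) unfolding carrier_coker by blast
  then show ?thesis
    by (simp add: trivial_group_def group_coker)
qed

end

theorem corollary6p16:
  fixes E :: "('v, 'e) pre_digraph" and p :: "'e \<Rightarrow> nat"
  assumes "fin_digraph E"
    and "arcs E \<noteq> {}"
    and "\<And>v w. v \<in> verts E \<Longrightarrow> w \<in> verts E \<Longrightarrow>
           \<exists>\<mu> \<in> paths E. path_range \<mu> = v \<and> path_source E \<mu> = w"
    and "\<And>e. e \<in> arcs E \<Longrightarrow> p e \<noteq> 0"
  shows "((\<forall>e \<in> arcs E. p e = 1) \<longrightarrow>
            odometer_homology 0 E p \<cong> integer_group \<and>
            (\<exists>n. int n = 2 - euler_char E \<and> odometer_homology 1 E p \<cong> int_power n) \<and>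
            (\<exists>n. int n = 1 - euler_char E \<and> odometer_homology 2 E p \<cong> int_power n))
       \<and> ((\<exists>e \<in> arcs E. p e > 1) \<longrightarrow>
            finite (carrier (odometer_coker E p)) \<and> cyclic_group (odometer_coker E p) \<and>
            odometer_homology 0 E p \<cong> integer_group \<and>
            (\<exists>n. int n = - euler_char E \<and> odometer_homology 2 E p \<cong> int_power n) \<and>
            (\<exists>n f g. int n = 1 - euler_char E \<and>
               f \<in> mon (int_power n) (odometer_homology 1 E p) \<and>
               g \<in> epi (odometer_homology 1 E p) (odometer_coker E p) \<and>
               f ` carrier (int_power n) =
                 kernel (odometer_homology 1 E p) (odometer_coker E p) g) \<and>
            (Gcd {int (path_weight p \<mu>) - int (path_weight p \<nu>) | \<mu> \<nu>.
                    \<mu> \<in> paths E \<and> \<nu> \<in> paths E \<and>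
                    path_source E \<mu> = path_source E \<nu> \<and> path_range \<mu> = path_range \<nu>} = 1 \<longrightarrow>
               trivial_group (odometer_coker E p) \<and>
               (\<exists>n. int n = 1 - euler_char E \<and> odometer_homology 1 E p \<cong> int_power n)))"
proof -
  interpret fin_digraph E by fact
  interpret strongly_connected_odometer E p
    using assms by unfold_locales auto
  show ?thesis
  proof (intro conjI impI)
    assume one: "\<forall>e \<in> arcs E. p e = 1"
    obtain n where n: "int n = 1 - euler_char E" "odometer_homology 2 E p \<cong> int_power n"
      "odometer_homology 1 E p \<cong> int_power (Suc n)"
      using weights_one[OF one] .
    show "\<exists>n. int n = 2 - euler_char E \<and> odometer_homology 1 E p \<cong> int_power n"
      using n by (intro exI[of _ "Suc n"]) simp
    show "\<exists>n. int n = 1 - euler_char E \<and> odometer_homology 2 E p \<cong> int_power n"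
      using n by blast
  next
    assume "\<exists>e \<in> arcs E. p e > 1"
    then obtain e where e: "e \<in> arcs E" "p e > 1" by blast
    obtain n where n: "int n = 1 - euler_char E"
      "free_of_rank {u \<in> frag_space (arcs E). M1 u = 0} n"
      using free_of_rank_kernel_M1 by blast
    \<comment> \<open>Only the edge summand is replaced by a power of the integers. The exact
      sequence asked for is the split one of this product, and it loses its cokernel when the gcd is
      1.\<close>
    have H1: "odometer_homology 1 E p \<cong> odometer_coker E p \<times>\<times> int_power n"
      using homology_1(2) group.DirProd_iso_trans[OF group_coker iso_refl kernel_group_iso_int_power[OF n(2)]]
      by (rule iso_trans)
    show "finite (carrier (odometer_coker E p))" by (rule finite_coker[OF e])
    show "\<exists>n. int n = - euler_char E \<and> odometer_homology 2 E p \<cong> int_power n"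
    proof -
      obtain k where "int k = - euler_char E" "free_of_rank {u \<in> frag_space (arcs E). M u = 0} k"
        using free_of_rank_kernel_M[OF e] by blast
      then show ?thesis
        using iso_trans[OF homology_2 kernel_group_iso_int_power] by blast
    qed
    show "\<exists>n f g. int n = 1 - euler_char E \<and>
         f \<in> mon (int_power n) (odometer_homology 1 E p) \<and>
         g \<in> epi (odometer_homology 1 E p) (odometer_coker E p) \<and>
         f ` carrier (int_power n) = kernel (odometer_homology 1 E p) (odometer_coker E p) g"
      by (rule DirProd_short_exact[OF group_coker group_int_power homology_1(1) H1]) (use n(1) in blast)
    assume gcd: "Gcd {int (path_weight p \<mu>) - int (path_weight p \<nu>) | \<mu> \<nu>.
                    \<mu> \<in> paths E \<and> \<nu> \<in> paths E \<and>
                    path_source E \<mu> = path_source E \<nu> \<and> path_range \<mu> = path_range \<nu>} = 1"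
    show trivial: "trivial_group (odometer_coker E p)"
      by (rule trivial_coker[OF e gcd])
    show "\<exists>n. int n = 1 - euler_char E \<and> odometer_homology 1 E p \<cong> int_power n"
      using iso_trans[OF H1 DirProd_trivial_group[OF group_coker group_int_power trivial]] n(1)
      by (intro exI[of _ n] conjI)
  qed (rule homology_0 cyclic_coker)+
qed

end
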